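(* Let $n\ge 1$ and $m\ge 1$ be integers, and let $H^{+}_{n+1}(x,y)$ and $H^{-}_{m+1}(x,y)$ be real homogeneous polynomials, not identically zero, of degrees $n+1$ and $m+1$ respectively. Let $X$ be the planar piecewise Hamiltonian system with switching line $y=0$ given by $X=X_+$ for $y\ge 0$ and $X=X_-$ for $y<0$, where $$X_{\pm}:\quad \frac{dx}{dt}=-\frac{\partial H_{\pm}}{\partial y}(x,y),\qquad \frac{dy}{dt}=\frac{\partial H_{\pm}}{\partial x}(x,y),$$ $$H_{+}(x,y)=\frac{x^2+y^2}{2}+H^{+}_{n+1}(x,y),\qquad H_{-}(x,y)=\frac{x^2+y^2}{2}+H^{-}_{m+1}(x,y).$$ If $n$ is odd and $m$ is even, then the origin is not an isochronous $\Sigma$-center of $X$.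
   Context: The origin is a $\Sigma$-center of $X$ if it has a neighborhood in which it is surrounded by closed orbits, each formed by a trajectory of $X_+$ in the upper half plane and a trajectory of $X_-$ in the lower half plane. Explicitly: for every sufficiently small $p>0$, the trajectory of $X_+$ starting at $(p,0)$ runs through $\{y>0\}$ until it meets the negative $x$-axis at a point $(\varphi_+(p),0)$, the trajectory of $X_-$ in $\{y<0\}$ that ends at $(p,0)$ starts at a point $(\varphi_-(p),0)$ of the negative $x$-axis, and $\varphi_+(p)=\varphi_-(p)$; the closed orbit $\gamma$ through $(p,0)$ is the union of these two arcs. The period $T(\gamma)$ of such a closed orbit is the sum of the times spent along the $X_+$-arc and the $X_-$-arc. A $\Sigma$-center is isochronous if $T(\gamma)$ is constant, i.e. independent of $\gamma$, for all closed orbits $\gamma$ surrounding it in a neighborhood. *)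

theory Defs
  imports "HOL-Analysis.Analysis"
begin

text \<open>Over the reals, polynomials in two variables are determined by the functions they induce,
  so a form of degree \<open>d\<close> is represented by its polynomial function.\<close>

definition homogeneous_poly2 :: "nat \<Rightarrow> (real \<Rightarrow> real \<Rightarrow> real) \<Rightarrow> bool" where
  "homogeneous_poly2 d F \<longleftrightarrow>
     (\<exists>a :: nat \<Rightarrow> real. \<forall>x y. F x y = (\<Sum>i\<le>d. a i * x ^ (d - i) * y ^ i))"

definition hamiltonian_field :: "(real \<Rightarrow> real \<Rightarrow> real) \<Rightarrow> real \<times> real \<Rightarrow> real \<times> real" where
  "hamiltonian_field H = (\<lambda>(x, y). (- deriv (\<lambda>v. H x v) y, deriv (\<lambda>u. H u y) x))"

definition trajectory_on ::
    "(real \<times> real \<Rightarrow> real \<times> real) \<Rightarrow> real \<Rightarrow> (real \<Rightarrow> real \<times> real) \<Rightarrow> bool" where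
  "trajectory_on X T \<gamma> \<longleftrightarrow>
     (\<forall>t\<in>{0..T}. (\<gamma> has_vector_derivative X (\<gamma> t)) (at t within {0..T}))"

text \<open>A piecewise system with switching line \<open>y = 0\<close> is given by the pair of fields
  \<open>Xp\<close> (upper half plane) and \<open>Xm\<close> (lower half plane). At their endpoints on the switching line
  the arcs below still satisfy the equation of their own field, with one-sided derivatives.\<close>

definition upper_arc ::
    "(real \<times> real \<Rightarrow> real \<times> real) \<Rightarrow> real \<Rightarrow> real \<Rightarrow> real \<Rightarrow> bool" where
  "upper_arc Xp p q T \<longleftrightarrow> 0 < T \<and> q < 0 \<and>
     (\<exists>\<gamma>. trajectory_on Xp T \<gamma> \<and> \<gamma> 0 = (p, 0) \<and> \<gamma> T = (q, 0) \<and>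
          (\<forall>t\<in>{0<..<T}. snd (\<gamma> t) > 0))"

definition lower_arc ::
    "(real \<times> real \<Rightarrow> real \<times> real) \<Rightarrow> real \<Rightarrow> real \<Rightarrow> real \<Rightarrow> bool" where
  "lower_arc Xm p q T \<longleftrightarrow> 0 < T \<and> q < 0 \<and>
     (\<exists>\<gamma>. trajectory_on Xm T \<gamma> \<and> \<gamma> 0 = (q, 0) \<and> \<gamma> T = (p, 0) \<and>
          (\<forall>t\<in>{0<..<T}. snd (\<gamma> t) < 0))"

text \<open>There is a closed orbit through \<open>(p, 0)\<close>, and it has period \<open>T\<close>. The common point \<open>q\<close>
  of the two arcs expresses that the half-return maps of the two fields agree at \<open>p\<close>.\<close>

definition closed_orbit_period ::
    "(real \<times> real \<Rightarrow> real \<times> real) \<Rightarrow> (real \<times> real \<Rightarrow> real \<times> real) \<Rightarrow> real \<Rightarrow> real \<Rightarrow> bool" where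
  "closed_orbit_period Xp Xm p T \<longleftrightarrow>
     (\<exists>q Tp Tm. upper_arc Xp p q Tp \<and> lower_arc Xm p q Tm \<and> T = Tp + Tm)"

definition sigma_center ::
    "(real \<times> real \<Rightarrow> real \<times> real) \<Rightarrow> (real \<times> real \<Rightarrow> real \<times> real) \<Rightarrow> bool" where
  "sigma_center Xp Xm \<longleftrightarrow>
     (\<exists>\<epsilon>>0. \<forall>p. 0 < p \<and> p < \<epsilon> \<longrightarrow> (\<exists>T. closed_orbit_period Xp Xm p T))"

definition isochronous_sigma_center ::
    "(real \<times> real \<Rightarrow> real \<times> real) \<Rightarrow> (real \<times> real \<Rightarrow> real \<times> real) \<Rightarrow> bool" where
  "isochronous_sigma_center Xp Xm \<longleftrightarrow> sigma_center Xp Xm \<and>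
     (\<exists>\<epsilon>>0. \<exists>T0. \<forall>p T. 0 < p \<and> p < \<epsilon> \<and> closed_orbit_period Xp Xm p T \<longrightarrow> T = T0)"

end

theory Submission
  imports Defs "HOL-Complex_Analysis.Complex_Analysis" "HOL-Real_Asymp.Real_Asymp"
begin

text \<open>In polar coordinates the time along a half orbit is \<open>\<integral> Phi c (z \<theta>) d\<theta>\<close> over \<open>[0, \<pi>]\<close>, where
  \<open>z = - 2 * s ^ (d - 2) * f\<close>, \<open>d\<close> is the degree, \<open>f\<close> the restriction of the form to the unit circle and
  \<open>s\<^sup>2 / 2\<close> the energy. As \<open>n + 1\<close> is even, an upper arc from \<open>p\<close> ends at \<open>- p\<close>; as \<open>m + 1\<close> is odd, the
  lower form must then vanish on the axis, so the lower arc has \<open>s = p\<close>. Hence in an isochronous center an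
  even function of \<open>p\<close> (the upper time) and a function of \<open>p ^ (m - 1)\<close> (the lower time), both
  real analytic, have constant sum for small \<open>p > 0\<close>, and therefore on the symmetric interval up to the first
  \<open>\<bar>p\<bar>\<close> at which an argument of \<open>Phi\<close> reaches the singularity. This \<open>\<bar>p\<bar>\<close> is finite, since \<open>m - 1\<close> is
  odd and so both signs of the lower form occur. There one of the two positive integrals tends to infinity, a
  contradiction.\<close>

section \<open>The period density\<close>

text \<open>For positive \<open>p\<close> alone nothing need become singular: if the lower form has
  one sign on the half circle, the arguments of its \<open>Phi\<close> may stay nonpositive for all
  \<open>p > 0\<close>, and the singularity lies at a positive argument. Hence the continuation to
  negative \<open>p\<close>, which have no meaning as orbits: there the lower argument changes its
  sign and the upper one does not. Positivity of both integrands prevents the two times from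
  compensating each other's divergence. The divergence combines two second-order effects:
  \<open>beta c\<close> has a nondegenerate maximum at \<open>vmax c\<close>, so \<open>Phi\<close>
  blows up like an inverse square root, and the argument, as a function of the angle, stays within a
  quadratic distance of its maximum. The upper time is even in \<open>p\<close> because
  \<open>s ^ 2\<close> is an even polynomial in \<open>p\<close> and only even powers of
  \<open>s\<close> enter, so that no square root survives.\<close>

text \<open>Let \<open>H = r\<^sup>2 / 2 + r ^ (j + 2) * f \<theta>\<close> in polar coordinates, \<open>c = j / 2\<close>, \<open>2 * H = s\<^sup>2\<close>
  and \<open>r = s * exp (v / 2)\<close>. Then conservation of energy reads
  \<open>beta c v = - 2 * s ^ j * f \<theta>\<close>, and along a trajectory \<open>dt / d\<theta> = Phi c (- 2 * s ^ j * f \<theta>)\<close>.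
  The angular speed is positive exactly for \<open>v < vmax c\<close>, and \<open>zmax c\<close> is the critical value.\<close>

definition beta :: "real \<Rightarrow> 'a \<Rightarrow> 'a :: {banach, real_normed_field}" where
  "beta c v = exp (- (of_real c * v)) - exp (- (of_real (c + 1) * v))"

text \<open>The exponential is factored out, so that for real \<open>v\<close> the sign is that of
  the last factor. Both functions are polymorphic: the real version describes the orbits, the
  complex one gives the analytic continuation.\<close>

definition beta' :: "real \<Rightarrow> 'a \<Rightarrow> 'a :: {banach, real_normed_field}" where
  "beta' c v = exp (- (of_real (c + 1) * v)) * (of_real (c + 1) - of_real c * exp v)"

definition vmax :: "real \<Rightarrow> real" where "vmax c = ln ((c + 1) / c)"

definition zmax :: "real \<Rightarrow> real" where "zmax c = beta c (vmax c)"

text \<open>Inverse of the increasing branch. For \<open>c > 0\<close> and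
  \<open>z \<ge> zmax c\<close> the description has no witness and the value is unspecified, so
  arguments of \<open>Phi\<close> have to be kept below \<open>zmax c\<close>.\<close>

definition beta_inv :: "real \<Rightarrow> real \<Rightarrow> real" where
  "beta_inv c z = (THE v. v < vmax c \<and> beta c v = z)"

definition Phi :: "real \<Rightarrow> real \<Rightarrow> real" where
  "Phi c z = exp (beta_inv c z) / ((c + 1) - c * exp (beta_inv c z))"

section \<open>The increasing branch of \<open>beta\<close> and its inverse\<close>

lemma beta_deriv:
  fixes v :: "'a :: {banach, real_normed_field}"
  shows "(beta c has_field_derivative beta' c v) (at v)"
proof -
  have e: "exp (- (of_real c * v)) = exp v * exp (- (of_real (c + 1) * v))"
    by (simp add: algebra_simps flip: exp_add)
  show ?thesis
    unfolding beta_def beta'_def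
    by (rule derivative_eq_intros refl)+ (unfold e, simp add: algebra_simps)
qed

lemma beta_of_real: "beta c (of_real v) = (of_real (beta c v) :: 'a :: {banach, real_normed_field})"
  and beta'_of_real: "beta' c (of_real v) = (of_real (beta' c v) :: 'a :: {banach, real_normed_field})"
  by (simp_all add: beta_def beta'_def flip: exp_of_real)

lemma exp_vmax: "c > 0 \<Longrightarrow> exp (vmax c) = (c + 1) / c"
  by (simp add: vmax_def)

lemma vmax_iff: "c > 0 \<Longrightarrow> v < vmax c \<longleftrightarrow> c * exp v < c + 1"
  by (subst exp_less_cancel_iff[symmetric]) (simp add: exp_vmax field_simps)

lemma beta'_pos: "c > 0 \<Longrightarrow> v < vmax c \<Longrightarrow> beta' c v > (0::real)"
  by (simp add: beta'_def vmax_iff)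

lemma vmax_pos: "c > 0 \<Longrightarrow> vmax c > 0"
  by (simp add: vmax_def)

text \<open>The derivative vanishes at \<open>vmax c\<close>, but the criterion asks for positivity
  only in the open interval. Admitting \<open>w = vmax c\<close> gives the comparison with
  \<open>zmax c\<close>.\<close>

lemma beta_strict_mono:
  assumes "c > 0" "v < w" "w \<le> vmax c" shows "beta c v < (beta c w :: real)"
proof (rule DERIV_pos_imp_increasing_open[OF assms(2)])
  fix x assume "v < x" "x < w"
  then show "\<exists>y. (beta c has_real_derivative y) (at x) \<and> 0 < y"
    using assms beta_deriv[of c x] beta'_pos[of c x] by (intro exI[of _ "beta' c x"]) auto
next
  show "continuous_on {v..w} (beta c)"
    unfolding beta_def by (intro continuous_intros)
qed

lemma beta_0 [simp]: "beta c 0 = 0"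
  by (simp add: beta_def)

lemma zmax_pos: "c > 0 \<Longrightarrow> zmax c > 0"
  using beta_strict_mono[of c 0 "vmax c"] vmax_pos[of c] by (simp add: zmax_def)

text \<open>Towards minus infinity the exponential with rate \<open>c + 1\<close> dominates, so
  \<open>beta c\<close> is unbounded below; the intermediate value theorem up to
  \<open>vmax c\<close> does the rest.\<close>

lemma beta_surj:
  assumes c: "c > 0" and z: "z < zmax c"
  shows "\<exists>v<vmax c. beta c v = z"
proof -
  have "filterlim (\<lambda>v::real. beta c v) at_bot at_bot"
    unfolding beta_def using c by simp real_asymp
  then have "eventually (\<lambda>v::real. beta c v \<le> z \<and> v \<le> vmax c) at_bot"
    by (intro eventually_conj) (auto simp: filterlim_at_bot eventually_le_at_bot)
  then obtain a where a: "beta c a \<le> z" "a \<le> vmax c"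
    using eventually_happens'[OF trivial_limit_at_bot_linorder] by fastforce
  have "\<exists>v\<ge>a. v \<le> vmax c \<and> beta c v = z"
    by (rule IVT') (use a z in \<open>auto simp: zmax_def beta_def intro!: continuous_intros\<close>)
  then obtain v where "v \<le> vmax c" "beta c v = z" by blast
  moreover from this have "v \<noteq> vmax c" using z by (auto simp: zmax_def)
  ultimately show ?thesis by (intro exI[of _ v]) auto
qed

lemma beta_inv_eqI:
  assumes "c > 0" "v < vmax c" "beta c v = z" shows "beta_inv c z = v"
  unfolding beta_inv_def
proof (rule the_equality)
  fix w assume "w < vmax c \<and> beta c w = z"
  then show "w = v"
    using beta_strict_mono[of c v w] beta_strict_mono[of c w v] assms
    by (cases v w rule: linorder_cases) auto
qed (use assms in auto)

lemma
  assumes "c > 0" "z < zmax c"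
  shows beta_inv_less: "beta_inv c z < vmax c" and beta_beta_inv: "beta c (beta_inv c z) = z"
  using beta_surj[OF assms] beta_inv_eqI[OF assms(1)] by auto

lemma Phi_pos: "c > 0 \<Longrightarrow> z < zmax c \<Longrightarrow> Phi c z > 0"
  using beta_inv_less[of c z] by (simp add: Phi_def vmax_iff)

lemma Phi_0: "c > 0 \<Longrightarrow> Phi c 0 = 1"
  using beta_inv_eqI[of c 0 0] vmax_pos[of c] by (simp add: Phi_def)

text \<open>With \<open>E = exp (vmax c)\<close> the denominator of \<open>Phi\<close> is
  \<open>c * (E - exp v)\<close>. As the maximum of \<open>beta c\<close> is nondegenerate,
  \<open>zmax c - z\<close> is at least a multiple of \<open>(E - exp v) ^ 2\<close>, which bounds
  the denominator by a square root. The condition \<open>0 \<le> z\<close> gives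
  \<open>v \<ge> 0\<close> and keeps the numerator at least 1.\<close>

lemma Phi_lower:
  assumes c: "c > 0"
  shows "\<exists>K>0. \<forall>z. 0 \<le> z \<longrightarrow> z < zmax c \<longrightarrow> K / sqrt (zmax c - z) \<le> Phi c z"
proof -
  \<comment> \<open>The smallest value for \<open>x \<le> vmax c\<close> of the factor in front of
    \<open>E - exp x\<close> in
    \<open>beta' c x = c * exp (- (c + 1) * x) * (E - exp x)\<close>.\<close>
  define k where "k = c * exp (- (c + 1) * vmax c)"
  have k: "k > 0" using c by (simp add: k_def)
  define E where "E = exp (vmax c)"
  have E: "E > 0" by (simp add: E_def)
  have cE: "c * E = c + 1" using c by (simp add: E_def exp_vmax)
  have est: "k * (E - exp v)\<^sup>2 / (2 * E) \<le> zmax c - beta c v" if v: "0 \<le> v" "v < vmax c" for v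
  proof -
    \<comment> \<open>The sum is nondecreasing up to \<open>vmax c\<close>, where the quadratic term
      vanishes.\<close>
    have "beta c v + k * (E - exp v)\<^sup>2 / (2 * E) \<le> beta c (vmax c) + k * (E - exp (vmax c))\<^sup>2 / (2 * E)"
    proof (rule DERIV_nonneg_imp_nondecreasing[where
          f = "\<lambda>v. beta c v + k * (E - exp v)\<^sup>2 / (2 * E)" and a = v and b = "vmax c"])
      fix x assume x: "v \<le> x" "x \<le> vmax c"
      have D: "((\<lambda>v. beta c v + k * (E - exp v)\<^sup>2 / (2 * E)) has_real_derivative
          beta' c x - k * (E - exp x) * exp x / E) (at x)"
        using E by (auto intro!: derivative_eq_intros beta_deriv simp: power2_eq_square field_simps)
      have "beta' c x = exp (- ((c + 1) * x)) * (c * E - c * exp x)"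
        by (simp add: beta'_def cE)
      then have "beta' c x = c * exp (- (c + 1) * x) * (E - exp x)"
        by (simp add: algebra_simps)
      moreover have "k * (E - exp x) * exp x / E \<le> k * (E - exp x)"
      proof -
        have "exp x / E \<le> 1" using x by (simp add: E_def)
        moreover have "k * (E - exp x) \<ge> 0" using k x by (simp add: E_def)
        ultimately show ?thesis using mult_left_mono[of "exp x / E" 1 "k * (E - exp x)"] by simp
      qed
      moreover have "k * (E - exp x) \<le> c * exp (- (c + 1) * x) * (E - exp x)"
        unfolding k_def using x c by (intro mult_right_mono) (auto simp: E_def)
      ultimately have "beta' c x - k * (E - exp x) * exp x / E \<ge> 0" by linarith
      with D show "\<exists>y. ((\<lambda>v. beta c v + k * (E - exp v)\<^sup>2 / (2 * E)) has_real_derivative y) (at x) \<and> 0 \<le> y"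
        by blast
    qed (use v in simp)
    then show ?thesis by (simp add: E_def zmax_def)
  qed
  define K where "K = sqrt (k / (2 * E)) / c"
  have "K / sqrt (zmax c - z) \<le> Phi c z" if z: "0 \<le> z" "z < zmax c" for z
  proof -
    define v where "v = beta_inv c z"
    have v: "v < vmax c" "beta c v = z" using beta_inv_less beta_beta_inv c z by (auto simp: v_def)
    have v0: "v \<ge> 0"
    proof (rule ccontr)
      assume "\<not> v \<ge> 0"
      then show False using beta_strict_mono[of c v 0] v z c vmax_pos[of c] by auto
    qed
    have "sqrt (k * (E - exp v)\<^sup>2 / (2 * E)) \<le> sqrt (zmax c - z)"
      using est[OF v0 v(1)] v by simp
    moreover have "sqrt (k * (E - exp v)\<^sup>2 / (2 * E)) = c * K * (E - exp v)"
      using v c E by (simp add: K_def real_sqrt_mult real_sqrt_divide E_def)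
    ultimately have *: "c * K * (E - exp v) \<le> sqrt (zmax c - z)" by simp
    have Kp: "K > 0" using k E c by (simp add: K_def)
    have pos: "E - exp v > 0" using v by (simp add: E_def)
    have "K / sqrt (zmax c - z) \<le> K / (c * K * (E - exp v))"
      using * Kp pos c by (intro divide_left_mono) (auto intro!: mult_pos_pos simp: z)
    also have "\<dots> = 1 / (c * (E - exp v))" using Kp by simp
    also have "\<dots> \<le> exp v / (c * (E - exp v))"
      using v0 c pos by (intro divide_right_mono) auto
    also have "\<dots> = Phi c z"
      using cE by (simp add: Phi_def v_def algebra_simps)
    finally show ?thesis .
  qed
  moreover have "K > 0" using k E c by (simp add: K_def)
  ultimately show ?thesis by blast
qed

lemma beta_inv_strict_mono:
  assumes "c > 0" "z < w" "w < zmax c" shows "beta_inv c z < beta_inv c w"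
proof (rule ccontr)
  assume "\<not> beta_inv c z < beta_inv c w"
  then have "beta_inv c w = beta_inv c z \<or> beta_inv c w < beta_inv c z" by auto
  then show False
    using beta_strict_mono[of c "beta_inv c w" "beta_inv c z"] beta_beta_inv[of c z] beta_beta_inv[of c w] beta_inv_less[of c z] assms
    by auto
qed

section \<open>Real analytic functions and parameter integrals\<close>

text \<open>Analyticity is encoded by a holomorphic extension to a disc instead of a power series,
  so that the complex identity theorem and holomorphic parameter integrals apply directly.\<close>

definition real_analytic_at :: "(real \<Rightarrow> real) \<Rightarrow> real \<Rightarrow> bool" where
  "real_analytic_at f p \<longleftrightarrow> (\<exists>r>0. \<exists>F. F holomorphic_on ball (of_real p) r \<and>
     (\<forall>x. \<bar>x - p\<bar> < r \<longrightarrow> F (of_real x) = complex_of_real (f x)))"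

lemma real_analytic_add:
  assumes "real_analytic_at f p" "real_analytic_at g p" shows "real_analytic_at (\<lambda>x. f x + g x) p"
proof -
  obtain r F where F: "r > 0" "F holomorphic_on ball (of_real p) r"
      "\<And>x. \<bar>x - p\<bar> < r \<Longrightarrow> F (of_real x) = complex_of_real (f x)"
    using assms(1) unfolding real_analytic_at_def by blast
  obtain s G where G: "s > 0" "G holomorphic_on ball (of_real p) s"
      "\<And>x. \<bar>x - p\<bar> < s \<Longrightarrow> G (of_real x) = complex_of_real (g x)"
    using assms(2) unfolding real_analytic_at_def by blast
  have "(\<lambda>z. F z + G z) holomorphic_on ball (of_real p) (min r s)"
    by (intro holomorphic_intros holomorphic_on_subset[OF F(2)] holomorphic_on_subset[OF G(2)]) auto
  then show ?thesis
    unfolding real_analytic_at_def using F G by (intro exI[of _ "min r s"] conjI exI[of _ "\<lambda>z. F z + G z"]) auto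
qed

text \<open>The property of being equal to \<open>c\<close> near a point spreads through each disc
  of extension by the identity theorem, and from there through the interval by
  connectedness.\<close>

lemma real_analytic_const_continuation:
  assumes an: "\<And>x. x \<in> {a<..<b} \<Longrightarrow> real_analytic_at f x"
    and ab: "a \<le> a'" "a' < b'" "b' \<le> b" and eq: "\<And>x. x \<in> {a'<..<b'} \<Longrightarrow> f x = c"
    and x: "x \<in> {a<..<b}"
  shows "f x = c"
proof -
  let ?P = "\<lambda>y. eventually (\<lambda>x. f x = c) (nhds y)"
  have "?P x"
  proof (rule connected_induction_simple[of "{a<..<b}" "(a' + b') / 2" x ?P])
    show "?P ((a' + b') / 2)"
      unfolding eventually_nhds
      by (rule exI[of _ "{a'<..<b'}"]) (use ab eq in auto)
  next
    fix y assume y: "y \<in> {a<..<b}"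
    obtain r F where F: "r > 0" "F holomorphic_on ball (of_real y) r"
        "\<And>x. \<bar>x - y\<bar> < r \<Longrightarrow> F (of_real x) = complex_of_real (f x)"
      using an[OF y] unfolding real_analytic_at_def by blast
    \<comment> \<open>The zeros of \<open>F - c\<close> accumulate at \<open>u\<close>, so
      \<open>F = c\<close> on the whole disc and \<open>f = c\<close> on its real diameter.\<close>
    have step: "?P w" if u: "\<bar>u - y\<bar> < r" "?P u" and w: "\<bar>w - y\<bar> < r" for u w
    proof -
      obtain e where e: "e > 0" "\<And>x. \<bar>x - u\<bar> < e \<Longrightarrow> f x = c"
        using u(2) by (auto simp: eventually_nhds_metric dist_real_def)
      define d where "d = min e (r - \<bar>u - y\<bar>)"
      have d: "d > 0" "d \<le> e" "d \<le> r - \<bar>u - y\<bar>" using e u by (auto simp: d_def)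
      have Fc: "F z - of_real c = 0" if z: "z \<in> ball (of_real y) r" for z
      proof (rule analytic_continuation[of "\<lambda>z. F z - of_real c" "ball (of_real y) r"
            "of_real ` ball u d" "of_real u" z])
        show "(\<lambda>z. F z - of_real c) holomorphic_on ball (of_real y) r"
          by (intro holomorphic_intros F)
        show "of_real ` ball u d \<subseteq> ball (complex_of_real y) r"
          using d by (auto simp: dist_of_real dist_real_def)
        show "complex_of_real u islimpt of_real ` ball u d"
          unfolding islimpt_approachable
        proof (intro allI impI)
          fix \<epsilon> :: real assume "\<epsilon> > 0"
          define t where "t = u + min \<epsilon> d / 2"
          have "t \<in> ball u d" "t \<noteq> u" "dist t u < \<epsilon>"
            using \<open>\<epsilon> > 0\<close> d by (auto simp: t_def dist_real_def)
          then have "of_real t \<in> complex_of_real ` ball u d" "of_real t \<noteq> complex_of_real u"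
               "dist (of_real t) (complex_of_real u) < \<epsilon>"
            by (auto simp: dist_of_real)
          then show "\<exists>x'\<in>complex_of_real ` ball u d. x' \<noteq> of_real u \<and> dist x' (of_real u) < \<epsilon>" by blast
        qed
        show "F z - of_real c = 0" if "z \<in> of_real ` ball u d" for z
          using that d F(3) e(2) by (force simp: dist_real_def)
      qed (use z u in \<open>auto simp: dist_of_real dist_real_def\<close>)
      show "?P w"
        unfolding eventually_nhds
      proof (rule exI[of _ "{y - r<..<y + r}"], intro conjI ballI)
        fix t assume "t \<in> {y - r<..<y + r}"
        then have t: "\<bar>t - y\<bar> < r" by auto
        then have "of_real t \<in> ball (complex_of_real y) r"
          by (simp add: dist_of_real dist_real_def abs_minus_commute)
        from Fc[OF this] F(3)[OF t] show "f t = c" by simp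
      qed (use w in auto)
    qed
    show "\<exists>T. openin (top_of_set {a<..<b}) T \<and> y \<in> T \<and> (\<forall>x\<in>T. \<forall>w\<in>T. ?P x \<longrightarrow> ?P w)"
    proof (intro exI conjI ballI impI)
      show "openin (top_of_set {a<..<b}) ({a<..<b} \<inter> {y - r<..<y + r})"
        by (intro openin_open_Int) auto
      fix u w assume "u \<in> {a<..<b} \<inter> {y - r<..<y + r}" "w \<in> {a<..<b} \<inter> {y - r<..<y + r}" "?P u"
      then show "?P w" by (intro step[of u w]) auto
    qed (use y F(1) in auto)
  qed (use x ab in auto)
  then show ?thesis by (rule eventually_nhds_x_imp_x)
qed

text \<open>\<open>beta\<close> is injective on a thin complex box around a compact real interval,
  because there its derivative has positive real part.\<close>

lemma Phi_holomorphic_extension: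
  assumes c: "c > 0" and z: "z1 \<le> z2" "z2 < zmax c"
  obtains U G where "open U" "complex_of_real ` {z1..z2} \<subseteq> U" "G holomorphic_on U"
    "\<And>x. complex_of_real x \<in> U \<Longrightarrow> x < zmax c \<and> G (of_real x) = of_real (Phi c x)"
proof -
  \<comment> \<open>\<open>z1 - 1\<close> and \<open>z3\<close> leave slack on both sides, so that
    the preimages of \<open>{z1..z2}\<close> lie inside the open box \<open>W\<close>.\<close>
  define z3 where "z3 = (z2 + zmax c) / 2"
  have z3: "z2 < z3" "z3 < zmax c" using z by (auto simp: z3_def)
  define v1 v2 where "v1 = beta_inv c (z1 - 1)" and "v2 = beta_inv c z3"
  have v2: "v2 < vmax c" using beta_inv_less c z3 by (simp add: v2_def)
  define S where "S = {v::complex. 0 < Re (beta' c v)}"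
  have "open S"
    unfolding S_def beta'_def by (intro open_Collect_less continuous_intros)
  moreover have "of_real ` {v1..v2} \<subseteq> S"
    using v2 c by (auto simp: S_def beta'_of_real beta'_pos)
  moreover have "compact (complex_of_real ` {v1..v2})"
    by (intro compact_continuous_image continuous_intros) auto
  ultimately obtain e where e: "e > 0" "(\<Union>x\<in>complex_of_real ` {v1..v2}. ball x e) \<subseteq> S"
    using compact_subset_open_imp_ball_epsilon_subset[of "of_real ` {v1..v2}" S] by blast
  define W where "W = box (Complex v1 (- e)) (Complex v2 e)"
  have W: "w \<in> W \<longleftrightarrow> v1 < Re w \<and> Re w < v2 \<and> \<bar>Im w\<bar> < e" for w
    by (auto simp: W_def in_box_complex_iff)
  have pos: "Re (beta' c w) > 0" if "w \<in> W" for w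
  proof -
    have "w \<in> ball (complex_of_real (Re w)) e"
      using that W by (simp add: dist_norm cmod_def)
    with e(2) that have "w \<in> S" unfolding W by force
    then show ?thesis by (simp add: S_def)
  qed
  have inj: "inj_on (beta c) W"
  proof (rule inj_onI, rule ccontr)
    fix u w assume uw: "u \<in> W" "w \<in> W" "beta c u = beta c w" "u \<noteq> w"
    \<comment> \<open>Division by \<open>w - u\<close> turns the mean value theorem for real parts
      into a statement about \<open>Re (beta' c x)\<close>; the segment stays in \<open>W\<close>
      because a box is convex.\<close>
    have "\<exists>x. x \<in> closed_segment u w \<and> Re (beta c w / (w - u)) - Re (beta c u / (w - u))
        = Re ((beta' c x / (w - u)) * (w - u))"
      by (rule complex_mvt_line) (intro DERIV_cdivide beta_deriv)
    moreover have "closed_segment u w \<subseteq> W"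
      using uw by (intro closed_segment_subset) (auto simp: W_def)
    ultimately obtain x where "x \<in> W" "Re (beta' c x) = 0" using uw by auto
    then show False using pos[of x] by simp
  qed
  have hol: "beta c holomorphic_on W"
    unfolding beta_def by (intro holomorphic_intros)
  have oW: "open W" by (simp add: W_def open_box)
  obtain g where g: "g holomorphic_on beta c ` W" "\<And>w. w \<in> W \<Longrightarrow> g (beta c w) = w"
    by (rule holomorphic_has_inverse[OF hol oW inj]) (rule that, assumption+)
  \<comment> \<open>The image of \<open>W\<close> might contain real numbers coming from nonreal
    \<open>v\<close>. The restriction on \<open>Re z\<close> ensures that each real point of
    \<open>U\<close> is the image of its own \<open>beta_inv\<close>, so that \<open>g\<close>
    extends \<open>beta_inv\<close>.\<close>
  define U where "U = beta c ` W \<inter> {z. z1 - 1 < Re z \<and> Re z < z3}"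
  have "open (beta c ` W)" by (rule open_mapping_thm3[OF hol oW inj])
  then have "open U" unfolding U_def
    by (intro open_Int open_Collect_conj open_Collect_less continuous_intros)
  have real: "complex_of_real (beta_inv c x) \<in> W \<and> beta c (of_real (beta_inv c x)) = complex_of_real x"
    if "z1 - 1 < x" "x < z3" for x
    using that beta_inv_strict_mono[of c "z1 - 1" x] beta_inv_strict_mono[of c x z3] z3 c e(1) beta_beta_inv[of c x]
    by (auto simp: W v1_def v2_def beta_of_real)
  show ?thesis
  proof
    show "open U" by fact
    show "complex_of_real ` {z1..z2} \<subseteq> U"
    proof safe
      fix x assume "x \<in> {z1..z2}"
      then show "complex_of_real x \<in> U"
        using real[of x] z3 by (auto simp: U_def intro!: image_eqI[of _ _ "of_real (beta_inv c x)"])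
    qed
    have nz: "of_real (c + 1) - of_real c * exp (g z) \<noteq> 0" if "z \<in> U" for z
    proof -
      have "g z \<in> W" using that g by (auto simp: U_def)
      show ?thesis
      proof
        assume "of_real (c + 1) - of_real c * exp (g z) = 0"
        then have "beta' c (g z) = 0" by (simp only: beta'_def mult_zero_right)
        with pos[OF \<open>g z \<in> W\<close>] show False by simp
      qed
    qed
    show "(\<lambda>z. exp (g z) / (of_real (c + 1) - of_real c * exp (g z))) holomorphic_on U"
      by (intro holomorphic_intros nz holomorphic_on_subset[OF g(1)]) (auto simp: U_def)
    fix x assume x: "complex_of_real x \<in> U"
    then have x': "z1 - 1 < x" "x < z3" by (auto simp: U_def)
    then have "g (of_real x) = of_real (beta_inv c x)" using real[of x] g(2) by metis
    then show "x < zmax c \<and> exp (g (of_real x)) / (of_real (c + 1) - of_real c * exp (g (of_real x)))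
        = of_real (Phi c x)"
      using x' z3 by (simp add: Phi_def flip: exp_of_real)
  qed
qed

lemma continuous_on_Phi:
  assumes c: "c > 0" shows "continuous_on {..<zmax c} (Phi c)"
proof -
  have "isCont (Phi c) z" if "z < zmax c" for z
  proof -
    obtain U G where U: "open U" "complex_of_real ` {z..z} \<subseteq> U" "G holomorphic_on U"
      "\<And>x. complex_of_real x \<in> U \<Longrightarrow> x < zmax c \<and> G (of_real x) = of_real (Phi c x)"
      by (rule Phi_holomorphic_extension[OF c order_refl \<open>z < zmax c\<close>]) (rule that, assumption+)
    have "isCont G (of_real z)"
      using holomorphic_on_imp_continuous_on[OF U(3)] U(1,2) by (simp add: continuous_on_eq_continuous_at)
    then have "isCont (\<lambda>x. G (complex_of_real x)) z"
      by (rule isCont_o2[rotated]) (intro continuous_intros)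
    then have *: "isCont (\<lambda>x. Re (G (complex_of_real x))) z"
      by (rule bounded_linear.isCont[OF bounded_linear_Re])
    have "open (complex_of_real -` U)" using U(1) by (intro open_vimage continuous_intros)
    then have "eventually (\<lambda>x. x \<in> complex_of_real -` U) (nhds z)"
      using U(2) by (intro eventually_nhds_in_open) auto
    then have "eventually (\<lambda>x. Re (G (complex_of_real x)) = Phi c x) (nhds z)"
      by eventually_elim (use U(4) in auto)
    from isCont_cong[OF this] * show ?thesis by simp
  qed
  then show ?thesis by (intro continuous_at_imp_continuous_on) auto
qed

lemma continuous_on_Phi_compose:
  assumes "c > 0" "continuous_on {a..b} f" "\<And>t. t \<in> {a..b} \<Longrightarrow> f t < zmax c"
  shows "continuous_on {a..b} (\<lambda>t. Phi c (f t))"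
  using assms by (intro continuous_on_compose2[OF continuous_on_Phi]) auto

text \<open>The arguments \<open>e p * f t\<close> lie in a compact interval below
  \<open>zmax c\<close>, near which \<open>Phi\<close> extends holomorphically. For complex
  \<open>w\<close> close to \<open>p\<close> the arguments \<open>E w * f t\<close> stay in that
  neighborhood, and the integral may be differentiated under the sign.\<close>

lemma real_analytic_Phi_integral:
  assumes c: "c > 0" and f: "continuous_on {0..pi} f"
    and E: "E holomorphic_on UNIV" "\<And>x. E (of_real x) = complex_of_real (e x)"
    and less: "\<And>t. t \<in> {0..pi} \<Longrightarrow> e p * f t < zmax c"
  shows "real_analytic_at (\<lambda>p. integral {0..pi} (\<lambda>t. Phi c (e p * f t))) p"
proof -
  have cf: "continuous_on {0..pi} (\<lambda>t. e p * f t)" by (intro continuous_intros f)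
  have ne: "{0..pi} \<noteq> {}" by simp
  obtain t1 where t1: "t1 \<in> {0..pi}" "\<And>t. t \<in> {0..pi} \<Longrightarrow> e p * f t1 \<le> e p * f t"
    using continuous_attains_inf[OF compact_Icc ne cf] by blast
  obtain t2 where t2: "t2 \<in> {0..pi}" "\<And>t. t \<in> {0..pi} \<Longrightarrow> e p * f t \<le> e p * f t2"
    using continuous_attains_sup[OF compact_Icc ne cf] by blast
  define z1 z2 where "z1 = e p * f t1" and "z2 = e p * f t2"
  have z12: "z1 \<le> z2" "z2 < zmax c"
    using t1(2)[OF t2(1)] less[OF t2(1)] by (simp_all add: z1_def z2_def)
  obtain U G where U: "open U" "complex_of_real ` {z1..z2} \<subseteq> U" "G holomorphic_on U"
      "\<And>x. complex_of_real x \<in> U \<Longrightarrow> x < zmax c \<and> G (of_real x) = of_real (Phi c x)"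
    by (rule Phi_holomorphic_extension[OF c z12]) (rule that, assumption+)
  have "compact (complex_of_real ` {z1..z2})"
    by (intro compact_continuous_image continuous_intros) auto
  then obtain d where d: "d > 0" "(\<Union>x\<in>complex_of_real ` {z1..z2}. ball x d) \<subseteq> U"
    using compact_subset_open_imp_ball_epsilon_subset[OF _ U(1,2)] by blast
  then have d': "ball (of_real x) d \<subseteq> U" if "x \<in> {z1..z2}" for x
    using that by (simp only: UN_subset_iff ball_simps)
  have "bounded (f ` {0..pi})"
    by (intro compact_imp_bounded compact_continuous_image f) auto
  then obtain M where M: "M > 0" "\<And>t. t \<in> {0..pi} \<Longrightarrow> \<bar>f t\<bar> \<le> M"
    unfolding bounded_pos ball_simps real_norm_def by blast
  \<comment> \<open>Since \<open>f\<close> is bounded by \<open>M\<close>, a change of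
    \<open>E\<close> by less than \<open>d / M\<close> moves each argument by less than
    \<open>d\<close>.\<close>
  have "isCont E (of_real p)"
    using holomorphic_on_imp_continuous_on[OF E(1)] by (simp add: continuous_on_eq_continuous_at)
  then obtain r where r: "r > 0" "\<And>w. dist w (of_real p) < r \<Longrightarrow> dist (E w) (E (of_real p)) < d / M"
    using divide_pos_pos[OF d(1) M(1)] by (fastforce simp: continuous_at_eps_delta dest: spec)
  let ?B = "ball (complex_of_real p) r"
  have inU: "E w * of_real (f t) \<in> U" if "w \<in> ?B" "t \<in> {0..pi}" for w t
  proof -
    have "dist (of_real (e p * f t)) (E w * of_real (f t)) = dist (E w) (E (of_real p)) * \<bar>f t\<bar>"
      by (simp add: dist_norm E(2) norm_minus_commute norm_mult flip: left_diff_distrib)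
    also have "\<dots> \<le> dist (E w) (E (of_real p)) * M"
      using M(2) that(2) by (intro mult_left_mono) auto
    also have "\<dots> < d / M * M"
      using M(1) r(2)[of w] that(1) by (intro mult_strict_right_mono) (auto simp: dist_commute)
    finally have "E w * of_real (f t) \<in> ball (of_real (e p * f t)) d" using M(1) by simp
    moreover have "e p * f t \<in> {z1..z2}"
      using t1(2)[OF that(2)] t2(2)[OF that(2)] by (simp only: z1_def z2_def atLeastAtMost_iff simp_thms)
    ultimately show ?thesis using d' by (meson subsetD)
  qed
  have contE: "continuous_on A E" for A
    by (rule continuous_on_subset[OF holomorphic_on_imp_continuous_on[OF E(1)]]) auto
  have contf: "continuous_on (?B \<times> cbox 0 pi) (\<lambda>x. of_real (f (snd x)) :: complex)"
    by (intro continuous_intros continuous_on_compose2[OF f]) auto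
  have dE: "(E has_field_derivative deriv E w) (at w)" for w
    by (rule holomorphic_derivI[OF E(1)]) auto
  have "(\<lambda>w. integral (cbox 0 pi) (\<lambda>t. G (E w * of_real (f t)))) holomorphic_on ?B"
  proof (rule leibniz_rule_holomorphic)
    fix w t assume w: "w \<in> ?B" and t: "t \<in> cbox 0 pi"
    have "E w * of_real (f t) \<in> U" using inU w t by simp
    then have "(G has_field_derivative deriv G (E w * of_real (f t))) (at (E w * of_real (f t)))"
      by (rule holomorphic_derivI[OF U(3,1)])
    then show "((\<lambda>w. G (E w * of_real (f t))) has_field_derivative
        deriv G (E w * of_real (f t)) * (deriv E w * of_real (f t))) (at w within ?B)"
      by (rule DERIV_chain2[OF _ DERIV_cmult_right[OF has_field_derivative_at_within[OF dE]]])
  next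
    fix w assume w: "w \<in> ?B"
    have "continuous_on {0..pi} (\<lambda>t. G (E w * of_real (f t)))"
      using inU w by (intro continuous_on_compose2[OF holomorphic_on_imp_continuous_on[OF U(3)]]
          continuous_intros f) auto
    then show "(\<lambda>t. G (E w * of_real (f t))) integrable_on cbox 0 pi"
      by (simp add: integrable_continuous_real)
  next
    have cG: "continuous_on U (deriv G)"
      by (intro holomorphic_on_imp_continuous_on holomorphic_deriv U)
    have "deriv E holomorphic_on UNIV" by (intro holomorphic_deriv E open_UNIV)
    then have cE: "continuous_on UNIV (deriv E)" by (rule holomorphic_on_imp_continuous_on)
    show "continuous_on (?B \<times> cbox 0 pi)
      (\<lambda>(w, t). deriv G (E w * of_real (f t)) * (deriv E w * of_real (f t)))"
      unfolding split_beta
      by (intro continuous_intros contf continuous_on_compose2[OF cG]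
          continuous_on_compose2[OF cE] continuous_on_compose2[OF contE[of UNIV]])
        (use inU in auto)
  qed auto
  moreover have "integral (cbox 0 pi) (\<lambda>t. G (E (of_real x) * of_real (f t)))
      = of_real (integral {0..pi} (\<lambda>t. Phi c (e x * f t)))" if x: "\<bar>x - p\<bar> < r" for x
  proof -
    have *: "e x * f t < zmax c \<and> G (E (of_real x) * of_real (f t)) = of_real (Phi c (e x * f t))"
      if "t \<in> {0..pi}" for t
      using U(4)[of "e x * f t"] inU[of "of_real x" t] x that
      by (auto simp: E(2) dist_of_real dist_real_def abs_minus_commute)
    have "continuous_on {0..pi} (\<lambda>t. Phi c (e x * f t))"
      using * by (intro continuous_on_Phi_compose c continuous_intros f) auto
    then have "((\<lambda>t. Phi c (e x * f t)) has_integral integral {0..pi} (\<lambda>t. Phi c (e x * f t))) {0..pi}"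
      by (intro integrable_integral integrable_continuous_real)
    then have "((\<lambda>t. complex_of_real (Phi c (e x * f t))) has_integral
        of_real (integral {0..pi} (\<lambda>t. Phi c (e x * f t)))) {0..pi}"
      by (rule has_integral_of_real)
    then have "((\<lambda>t. G (E (of_real x) * of_real (f t))) has_integral
        of_real (integral {0..pi} (\<lambda>t. Phi c (e x * f t)))) {0..pi}"
      by (rule has_integral_eq[rotated]) (use * in auto)
    then show ?thesis by (simp add: integral_unique)
  qed
  ultimately show ?thesis
    unfolding real_analytic_at_def
    by (intro exI[of _ r] conjI r(1) exI[of _ "\<lambda>w. integral (cbox 0 pi) (\<lambda>t. G (E w * of_real (f t)))"]
        allI impI)
qed

section \<open>The analytic core\<close>

text \<open>Smoothness is required on the whole line although the integrals run over
  \<open>{0..pi}\<close>: a maximum at an endpoint must still be a critical point.\<close>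

definition C2 :: "(real \<Rightarrow> real) \<Rightarrow> bool" where
  "C2 f \<longleftrightarrow> (\<exists>f' f''. (\<forall>x. (f has_real_derivative f' x) (at x)) \<and>
     (\<forall>x. (f' has_real_derivative f'' x) (at x)) \<and> continuous_on UNIV f'')"

lemma C2_imp_continuous: "C2 f \<Longrightarrow> continuous_on A f"
  unfolding C2_def by (meson DERIV_isCont continuous_at_imp_continuous_on)

lemma C2_const: "C2 (\<lambda>x. k)"
  unfolding C2_def by (rule exI[of _ "\<lambda>x. 0"])+ auto

lemma C2_add: assumes "C2 f" "C2 g" shows "C2 (\<lambda>x. f x + g x)"
proof -
  obtain f' f'' g' g'' where "\<And>x. (f has_real_derivative f' x) (at x)"
    "\<And>x. (f' has_real_derivative f'' x) (at x)" "continuous_on UNIV f''"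
    "\<And>x. (g has_real_derivative g' x) (at x)"
    "\<And>x. (g' has_real_derivative g'' x) (at x)" "continuous_on UNIV g''"
    using assms unfolding C2_def by blast
  then show ?thesis
    unfolding C2_def
    by (intro exI[of _ "\<lambda>x. f' x + g' x"] exI[of _ "\<lambda>x. f'' x + g'' x"])
      (auto intro!: derivative_intros continuous_intros)
qed

lemma C2_mult: assumes "C2 f" "C2 g" shows "C2 (\<lambda>x. f x * g x)"
proof -
  obtain f' f'' g' g'' where f: "\<And>x. (f has_real_derivative f' x) (at x)"
    "\<And>x. (f' has_real_derivative f'' x) (at x)" "continuous_on UNIV f''"
    and g: "\<And>x. (g has_real_derivative g' x) (at x)"
    "\<And>x. (g' has_real_derivative g'' x) (at x)" "continuous_on UNIV g''"
    using assms unfolding C2_def by blast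
  have "continuous_on UNIV f" "continuous_on UNIV f'" "continuous_on UNIV g" "continuous_on UNIV g'"
    using f g by (meson DERIV_isCont continuous_at_imp_continuous_on)+
  with f g show ?thesis
    unfolding C2_def
    by (intro exI[of _ "\<lambda>x. f' x * g x + f x * g' x"]
        exI[of _ "\<lambda>x. f'' x * g x + 2 * (f' x * g' x) + f x * g'' x"])
      (auto intro!: derivative_eq_intros continuous_intros)
qed

lemma C2_cos: "C2 cos" and C2_sin: "C2 sin"
  unfolding C2_def
  by (rule exI[of _ "\<lambda>x. - sin x"] exI[of _ "\<lambda>x. cos x"],
      rule exI[of _ "\<lambda>x. - cos x"] exI[of _ "\<lambda>x. - sin x"],
      auto intro!: derivative_eq_intros continuous_intros)+

lemma C2_power: "C2 f \<Longrightarrow> C2 (\<lambda>x. f x ^ n)"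
  by (induction n) (auto intro: C2_const C2_mult)

lemma C2_sum: "(\<And>i. i \<in> A \<Longrightarrow> C2 (f i)) \<Longrightarrow> C2 (\<lambda>x. \<Sum>i\<in>A. f i x)"
  by (induction A rule: infinite_finite_induct) (auto intro: C2_const C2_add)

text \<open>The first derivative vanishes at the global maximum, which leaves the second-order
  Taylor remainder; \<open>K\<close> bounds the second derivative within distance 1.\<close>

lemma C2_max_quadratic:
  assumes "C2 f" and max: "\<And>x. f x \<le> f t0"
  shows "\<exists>K>0. \<forall>t. \<bar>t - t0\<bar> \<le> 1 \<longrightarrow> f t0 - f t \<le> K * (t - t0)\<^sup>2"
proof -
  obtain f' f'' where f: "\<And>x. (f has_real_derivative f' x) (at x)"
    "\<And>x. (f' has_real_derivative f'' x) (at x)" "continuous_on UNIV f''"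
    using assms unfolding C2_def by blast
  have f'0: "f' t0 = 0"
    using DERIV_local_max[OF f(1), of 1 t0] max by simp
  have "bounded (f'' ` {t0 - 1..t0 + 1})"
    by (intro compact_imp_bounded compact_continuous_image continuous_on_subset[OF f(3)]) auto
  then obtain K where K: "K > 0" "\<And>x. x \<in> {t0 - 1..t0 + 1} \<Longrightarrow> \<bar>f'' x\<bar> \<le> K"
    unfolding bounded_pos by auto
  define d where "d = (\<lambda>n::nat. if n = 0 then f else if n = 1 then f' else f'')"
  have "f t0 - f t \<le> K * (t - t0)\<^sup>2" if t: "\<bar>t - t0\<bar> \<le> 1" for t
  proof (cases "t = t0")
    case False
    have "\<exists>s. (if t < t0 then t < s \<and> s < t0 else t0 < s \<and> s < t) \<and>
      f t = (\<Sum>m<2. d m t0 / fact m * (t - t0) ^ m) + d 2 s / fact 2 * (t - t0) ^ 2"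
      by (rule Taylor[where a = "t0 - 1" and b = "t0 + 1"])
        (use f t False in \<open>auto simp: d_def less_2_cases_iff\<close>)
    then obtain s where s: "if t < t0 then t < s \<and> s < t0 else t0 < s \<and> s < t"
      and eq: "f t = f t0 + f'' s / 2 * (t - t0)\<^sup>2"
      by (auto simp: d_def f'0 numeral_2_eq_2)
    have "s \<in> {t0 - 1..t0 + 1}" using s t by (auto split: if_splits)
    then have "- f'' s / 2 \<le> K" using K by fastforce
    from mult_right_mono[OF this, of "(t - t0)\<^sup>2"] eq show ?thesis by simp
  qed simp
  with K show ?thesis by blast
qed

text \<open>Near its maximum point the argument differs from \<open>zmax c\<close> by \<open>O((t - t0)\<^sup>2)\<close>, where \<open>Phi\<close> has an
  inverse square root singularity; so the integrand dominates \<open>C / \<bar>t - t0\<bar>\<close> and the integral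
  diverges logarithmically.\<close>

lemma Phi_integral_blowup:
  assumes c: "c > 0" and f: "C2 f" and le: "\<And>t. f t \<le> zmax c"
    and t0: "t0 \<in> {0..pi}" "f t0 = zmax c"
  shows "\<exists>m<1. 0 < m \<and> (\<forall>u. m < u \<and> u < 1 \<longrightarrow> M < integral {0..pi} (\<lambda>t. Phi c (u * f t)))"
proof -
  define z where "z = zmax c"
  have z: "z > 0" using zmax_pos c by (simp add: z_def)
  obtain K where K: "K > 0" "\<And>t. \<bar>t - t0\<bar> \<le> 1 \<Longrightarrow> z - f t \<le> K * (t - t0)\<^sup>2"
    using C2_max_quadratic[OF f, of t0] le t0 by (auto simp: z_def)
  obtain k where k: "k > 0" "\<And>y. 0 \<le> y \<Longrightarrow> y < z \<Longrightarrow> k / sqrt (z - y) \<le> Phi c y"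
    using Phi_lower[OF c] by (auto simp: z_def)
  \<comment> \<open>Distance 1 is the range of the Taylor bound. The other entry makes
    \<open>K * d0 ^ 2 \<le> z / 2\<close>, which together with \<open>m\<close> keeps
    \<open>u * f t\<close> nonnegative, as the lower bound for \<open>Phi\<close> requires.\<close>
  define d0 where "d0 = min 1 (sqrt (z / (2 * K)))"
  have d0: "d0 > 0" "d0 \<le> 1" using z K by (auto simp: d0_def)
  have d0K: "K * d0\<^sup>2 \<le> z / 2"
  proof -
    have "d0\<^sup>2 \<le> (sqrt (z / (2 * K)))\<^sup>2" using d0 by (intro power_mono) (auto simp: d0_def)
    also have "\<dots> = z / (2 * K)" using z K by simp
    finally show ?thesis using K by (simp add: field_simps)
  qed
  define C where "C = k / sqrt (2 * K)"
  have C: "C > 0" using k K by (simp add: C_def)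
  \<comment> \<open>Solves \<open>C * (ln d0 - ln d) = \<bar>M\<bar> + 1\<close>; the left side is
    the integral of \<open>C / \<bar>t - t0\<bar>\<close> over the distances from \<open>d\<close>
    to \<open>d0\<close>.\<close>
  define d where "d = d0 * exp (- (\<bar>M\<bar> + 1) / C)"
  have d: "d > 0" "d \<le> d0" using d0 C by (auto simp: d_def field_simps)
  have lnd: "C * (ln d0 - ln d) > M" using d0 C by (simp add: d_def ln_mult)
  \<comment> \<open>For \<open>u > m\<close> the defect \<open>z * (1 - u)\<close> is at most
    \<open>K * d ^ 2\<close>, hence absorbed by the quadratic term at distances of at least
    \<open>d\<close>; the entry \<open>1 / 2\<close> keeps it below \<open>z / 2\<close>.\<close>
  define m where "m = max (1 / 2) (1 - K * d\<^sup>2 / z)"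
  have m: "0 < m" "m < 1" "z * (1 - m) \<le> z / 2" "z * (1 - m) \<le> K * d\<^sup>2"
    using z K d by (auto simp: m_def field_simps max_def)
  have main: "M < integral {0..pi} (\<lambda>t. Phi c (u * f t))" if u: "m < u" "u < 1" for u
  proof -
    have less: "u * f t < z" for t
    proof -
      have "u * f t \<le> u * z" using le u m by (intro mult_left_mono) (auto simp: z_def)
      also have "\<dots> < z" using u z by simp
      finally show ?thesis .
    qed
    have ibl: "(\<lambda>t. Phi c (u * f t)) integrable_on {a..b}" for a b
      by (intro integrable_continuous_real continuous_on_Phi_compose c continuous_intros
          C2_imp_continuous f) (use less in \<open>auto simp: z_def\<close>)
    have nonneg: "0 \<le> Phi c (u * f t)" for t
      using Phi_pos[OF c, of "u * f t"] less by (simp add: z_def less_imp_le)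
    have lower: "C / \<bar>t - t0\<bar> \<le> Phi c (u * f t)" if t: "d \<le> \<bar>t - t0\<bar>" "\<bar>t - t0\<bar> \<le> d0" for t
    proof -
      have sq: "d\<^sup>2 \<le> (t - t0)\<^sup>2" "(t - t0)\<^sup>2 \<le> d0\<^sup>2"
        using t d power_mono[of d "\<bar>t - t0\<bar>" 2] power_mono[of "\<bar>t - t0\<bar>" d0 2] by auto
      have a: "z - u * f t = z * (1 - u) + u * (z - f t)" by (simp add: algebra_simps)
      have "z * (1 - u) \<le> z * (1 - m)" using u z by simp
      moreover have "u * (z - f t) \<le> K * (t - t0)\<^sup>2"
      proof -
        have "u * (z - f t) \<le> 1 * (z - f t)"
          using u le by (intro mult_right_mono) (auto simp: z_def)
        also have "\<dots> \<le> K * (t - t0)\<^sup>2" using K t d0 by simp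
        finally show ?thesis .
      qed
      moreover have "K * d\<^sup>2 \<le> K * (t - t0)\<^sup>2" "K * (t - t0)\<^sup>2 \<le> K * d0\<^sup>2"
        using sq K by auto
      ultimately have b: "z - u * f t \<le> 2 * K * (t - t0)\<^sup>2" "z - u * f t \<le> z"
        using a m d0K by linarith+
      have "C / \<bar>t - t0\<bar> = k / sqrt (2 * K * (t - t0)\<^sup>2)"
        by (simp add: C_def real_sqrt_mult)
      also have "\<dots> \<le> k / sqrt (z - u * f t)"
        using b less[of t] k t d K by (intro divide_left_mono mult_pos_pos) auto
      also have "\<dots> \<le> Phi c (u * f t)" using b less by (intro k) auto
      finally show ?thesis .
    qed
    \<comment> \<open>As \<open>d0 \<le> 1 < pi / 2\<close>, an interval of length \<open>d0\<close>
      fits on one side of \<open>t0\<close> even when \<open>t0\<close> is an endpoint.\<close>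
    have "\<exists>a b. {a..b} \<subseteq> {0..pi} \<and> (\<forall>t\<in>{a..b}. d \<le> \<bar>t - t0\<bar> \<and> \<bar>t - t0\<bar> \<le> d0) \<and>
        ((\<lambda>t. C / \<bar>t - t0\<bar>) has_integral (C * (ln d0 - ln d))) {a..b}"
    proof (cases "t0 \<le> pi / 2")
      case True
      have "((\<lambda>t. C / \<bar>t - t0\<bar>) has_integral (C * ln ((t0 + d0) - t0) - C * ln ((t0 + d) - t0))) {t0 + d..t0 + d0}"
        by (rule fundamental_theorem_of_calculus)
          (use d in \<open>auto intro!: derivative_eq_intros simp flip: has_real_derivative_iff_has_vector_derivative\<close>)
      moreover have "{t0 + d..t0 + d0} \<subseteq> {0..pi}" using True t0 d0 d pi_gt3 by auto
      ultimately show ?thesis using d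
        by (intro exI[of _ "t0 + d"] exI[of _ "t0 + d0"]) (auto simp: algebra_simps)
    next
      case False
      have "((\<lambda>t. C / \<bar>t - t0\<bar>) has_integral (- C * ln (t0 - (t0 - d)) - - C * ln (t0 - (t0 - d0)))) {t0 - d0..t0 - d}"
        by (rule fundamental_theorem_of_calculus)
          (use d in \<open>auto intro!: derivative_eq_intros simp flip: has_real_derivative_iff_has_vector_derivative\<close>)
      moreover have "{t0 - d0..t0 - d} \<subseteq> {0..pi}" using False t0 d0 d pi_gt3 by auto
      ultimately show ?thesis using d
        by (intro exI[of _ "t0 - d0"] exI[of _ "t0 - d"]) (auto simp: algebra_simps)
    qed
    then obtain a b where ab: "{a..b} \<subseteq> {0..pi}"
      "\<And>t. t \<in> {a..b} \<Longrightarrow> d \<le> \<bar>t - t0\<bar> \<and> \<bar>t - t0\<bar> \<le> d0"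
      "((\<lambda>t. C / \<bar>t - t0\<bar>) has_integral (C * (ln d0 - ln d))) {a..b}"
      by blast
    have "C * (ln d0 - ln d) \<le> integral {a..b} (\<lambda>t. Phi c (u * f t))"
      using ab(2) lower by (intro has_integral_le[OF ab(3) integrable_integral[OF ibl]]) auto
    also have "\<dots> \<le> integral {0..pi} (\<lambda>t. Phi c (u * f t))"
      using nonneg by (intro integral_subset_le ab ibl) auto
    finally show ?thesis using lnd by linarith
  qed
  show ?thesis using m main by (intro exI[of _ m]) auto
qed

text \<open>Here \<open>e p\<close> and \<open>p ^ j\<close> stand for the powers of
  \<open>s\<close> in the upper and the lower time. The hypotheses \<open>f_rep\<close> and
  \<open>g_rep\<close> turn bounds over \<open>{0..pi}\<close> into bounds over the line, as the
  blow-up needs; absolute values suffice for \<open>g\<close>, since both signs of \<open>p\<close>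
  are available. Both integrals being nonnegative, each is bounded by \<open>T0\<close>.\<close>

lemma period_sum_not_constant:
  fixes f g e :: "real \<Rightarrow> real"
  assumes c: "c1 > 0" "c2 > 0" and fg: "C2 f" "C2 g"
    and f_rep: "\<And>t. \<exists>s\<in>{0..pi}. f t = f s" and g_rep: "\<And>t. \<exists>s\<in>{0..pi}. \<bar>g t\<bar> = \<bar>g s\<bar>"
    and g_nz: "g t1 \<noteq> 0"
    and E: "E holomorphic_on UNIV" "\<And>x. E (of_real x) = complex_of_real (e x)"
    and e: "\<And>x. e (- x) = e x" "e 0 = 0" and j: "odd j" and p1: "p1 > 0"
  shows "\<exists>p. 0 < p \<and> p < p1 \<and> integral {0..pi} (\<lambda>t. Phi c1 (e p * f t))
      + integral {0..pi} (\<lambda>t. Phi c2 (p ^ j * g t)) \<noteq> T0"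
proof (rule ccontr)
  define I1 where "I1 = (\<lambda>p. integral {0..pi} (\<lambda>t. Phi c1 (e p * f t)))"
  define I2 where "I2 = (\<lambda>p. integral {0..pi} (\<lambda>t. Phi c2 (p ^ j * g t)))"
  assume "\<not> ?thesis"
  then have T0: "I1 p + I2 p = T0" if "0 < p" "p < p1" for p
    using that by (auto simp: I1_def I2_def)
  have j0: "j > 0" using j by (auto intro: Nat.gr0I)
  have z: "zmax c1 > 0" "zmax c2 > 0" using zmax_pos c by auto
  have cf: "continuous_on A f" and cg: "continuous_on A g" for A
    using fg C2_imp_continuous by auto
  have "e = (\<lambda>x. Re (E (of_real x)))" by (simp add: E(2))
  moreover have "continuous_on UNIV (\<lambda>x. Re (E (of_real x)))"
    by (intro continuous_intros continuous_on_compose2[OF holomorphic_on_imp_continuous_on[OF E(1)]]) auto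
  ultimately have "continuous_on UNIV e" by simp
  then have ce: "continuous_on A e" for A by (rule continuous_on_subset) auto
  have "continuous_on {0..pi} (\<lambda>t. \<bar>g t\<bar>)" by (intro continuous_intros cg)
  then obtain tm where tm: "tm \<in> {0..pi}" "\<And>t. t \<in> {0..pi} \<Longrightarrow> \<bar>g t\<bar> \<le> \<bar>g tm\<bar>"
    using continuous_attains_sup[of "{0..pi}" "\<lambda>t. \<bar>g t\<bar>"] by auto
  have gtm: "\<bar>g tm\<bar> > 0"
    using g_rep[of t1] tm(2) g_nz by fastforce
  \<comment> \<open>At \<open>pg\<close> the lower argument is critical in absolute value whatever
    the upper form does; so \<open>A\<close> below is nonempty and \<open>ps\<close> exists.\<close>
  define pg where "pg = root j (zmax c2 / \<bar>g tm\<bar>)"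
  have pg: "pg > 0" "\<bar>pg ^ j * g tm\<bar> = zmax c2"
    using gtm z j0 by (auto simp: pg_def abs_mult)
  (* The parameters p at which an argument of Phi reaches the critical value; the first such
     parameter ps ends the interval on which the sum of the two integrals is real analytic. *)
  define A where "A = {x \<in> {0..pg} \<times> {0..pi}.
      e (fst x) * f (snd x) = zmax c1 \<or> \<bar>fst x ^ j * g (snd x)\<bar> = zmax c2}"
  have "A = ({0..pg} \<times> {0..pi}) \<inter> ({x. e (fst x) * f (snd x) = zmax c1}
      \<union> {x. \<bar>fst x ^ j * g (snd x)\<bar> = zmax c2})"
    by (auto simp: A_def)
  moreover have "compact \<dots>"
    by (intro compact_Int_closed compact_Times compact_Icc closed_Un closed_Collect_eq
        continuous_intros continuous_on_compose2[OF ce[of UNIV]] continuous_on_compose2[OF cf[of UNIV]]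
        continuous_on_compose2[OF cg[of UNIV]]) auto
  ultimately have "compact (fst ` A)"
    by (intro compact_continuous_image continuous_intros) simp
  moreover have "(pg, tm) \<in> A" using pg tm by (simp add: A_def)
  ultimately obtain ps where ps: "ps \<in> fst ` A" "\<And>p. p \<in> fst ` A \<Longrightarrow> ps \<le> p"
    using compact_attains_inf[of "fst ` A"] by blast
  then obtain t0 where t0: "(ps, t0) \<in> A" by auto
  have psg: "0 \<le> ps" "ps \<le> pg" "t0 \<in> {0..pi}" using t0 by (auto simp: A_def)
  have ps0: "ps > 0"
    using t0 z e(2) j0 by (cases "ps = 0") (auto simp: A_def zero_power)
  have first: "ps \<le> p" if "0 \<le> p" "p \<le> pg" "t \<in> {0..pi}"
      "e p * f t = zmax c1 \<or> \<bar>p ^ j * g t\<bar> = zmax c2" for p t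
    using that ps(2)[of p] by (force simp: A_def)
  \<comment> \<open>All arguments vanish at \<open>p = 0\<close>, so exceeding the critical value
    before \<open>ps\<close> would produce an earlier critical parameter.\<close>
  have less_f: "e p * f t < zmax c1" if p: "0 \<le> p" "p < ps" and t: "t \<in> {0..pi}" for p t
  proof (rule ccontr)
    assume "\<not> e p * f t < zmax c1"
    then have "\<exists>q\<ge>0. q \<le> p \<and> e q * f t = zmax c1"
      using p z e(2) by (intro IVT') (auto intro!: continuous_intros ce)
    then obtain q where "0 \<le> q" "q \<le> p" "e q * f t = zmax c1" by blast
    then show False using first[of q t] p psg t by simp
  qed
  have less_g: "\<bar>p ^ j * g t\<bar> < zmax c2" if p: "0 \<le> p" "p < ps" and t: "t \<in> {0..pi}" for p t
  proof (rule ccontr)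
    assume "\<not> \<bar>p ^ j * g t\<bar> < zmax c2"
    then have "\<exists>q\<ge>0. q \<le> p \<and> \<bar>q ^ j * g t\<bar> = zmax c2"
      using p z j0 by (intro IVT') (auto intro!: continuous_intros simp: zero_power)
    then obtain q where "0 \<le> q" "q \<le> p" "\<bar>q ^ j * g t\<bar> = zmax c2" by blast
    then show False using first[of q t] p psg t by simp
  qed
  have le_f: "e ps * f t \<le> zmax c1" if t: "t \<in> {0..pi}" for t
  proof (rule ccontr)
    assume gt: "\<not> e ps * f t \<le> zmax c1"
    then have "\<exists>q\<ge>0. q \<le> ps \<and> e q * f t = zmax c1"
      using ps0 z e(2) by (intro IVT') (auto intro!: continuous_intros ce)
    then obtain q where q: "0 \<le> q" "q \<le> ps" "e q * f t = zmax c1" by blast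
    then show False using less_f[of q t] t gt by (cases "q = ps") auto
  qed
  have le_g: "\<bar>ps ^ j * g t\<bar> \<le> zmax c2" if t: "t \<in> {0..pi}" for t
  proof (rule ccontr)
    assume gt: "\<not> \<bar>ps ^ j * g t\<bar> \<le> zmax c2"
    then have "\<exists>q\<ge>0. q \<le> ps \<and> \<bar>q ^ j * g t\<bar> = zmax c2"
      using ps0 z j0 by (intro IVT') (auto intro!: continuous_intros simp: zero_power)
    then obtain q where q: "0 \<le> q" "q \<le> ps" "\<bar>q ^ j * g t\<bar> = zmax c2" by blast
    then show False using less_g[of q t] t gt by (cases "q = ps") auto
  qed
  \<comment> \<open>Changing the sign of \<open>p\<close> preserves \<open>e p\<close> and flips at
    most the sign of \<open>p ^ j * g t\<close>; the absolute value in \<open>A\<close> was taken to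
    cover both signs.\<close>
  have dom: "e p * f t < zmax c1" "p ^ j * g t < zmax c2"
    if "\<bar>p\<bar> < ps" "t \<in> {0..pi}" for p t
  proof -
    have "e p = e \<bar>p\<bar>" using e(1)[of p] by (auto simp: abs_if)
    then show "e p * f t < zmax c1" using less_f[of "\<bar>p\<bar>" t] that by simp
    have "\<bar>p ^ j * g t\<bar> = \<bar>\<bar>p\<bar> ^ j * g t\<bar>" by (simp add: abs_mult power_abs)
    then show "p ^ j * g t < zmax c2" using less_g[of "\<bar>p\<bar>" t] that by simp
  qed
  have an: "real_analytic_at (\<lambda>p. I1 p + I2 p) p" if "p \<in> {-ps<..<ps}" for p
    unfolding I1_def I2_def
  proof (rule real_analytic_add)
    show "real_analytic_at (\<lambda>p. integral {0..pi} (\<lambda>t. Phi c1 (e p * f t))) p"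
      by (rule real_analytic_Phi_integral[OF c(1) cf E]) (use dom that in auto)
    show "real_analytic_at (\<lambda>p. integral {0..pi} (\<lambda>t. Phi c2 (p ^ j * g t))) p"
      by (rule real_analytic_Phi_integral[OF c(2) cg, where E = "\<lambda>w. w ^ j"])
        (use dom that in \<open>auto intro!: holomorphic_intros\<close>)
  qed
  have const: "I1 p + I2 p = T0" if "p \<in> {-ps<..<ps}" for p
    by (rule real_analytic_const_continuation[OF an, where a' = 0 and b' = "min ps p1"]) (use that ps0 p1 T0 in auto)
  have I1_nonneg: "0 \<le> I1 p" if p: "\<bar>p\<bar> < ps" for p
    unfolding I1_def using dom(1)[OF p]
    by (intro integral_nonneg integrable_continuous_real continuous_on_Phi_compose less_imp_le[OF Phi_pos])
      (simp_all add: c continuous_on_mult_left cf)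
  have I2_nonneg: "0 \<le> I2 p" if p: "\<bar>p\<bar> < ps" for p
    unfolding I2_def using dom(2)[OF p]
    by (intro integral_nonneg integrable_continuous_real continuous_on_Phi_compose less_imp_le[OF Phi_pos])
      (simp_all add: c continuous_on_mult_left cg)
  have le_T0: "I1 p \<le> T0" "I2 p \<le> T0" if p: "\<bar>p\<bar> < ps" for p
    using const[of p] I1_nonneg[OF p] I2_nonneg[OF p] p by (simp_all add: abs_less_iff)
  consider "e ps * f t0 = zmax c1" | "\<bar>ps ^ j * g t0\<bar> = zmax c2"
    using t0 by (auto simp: A_def)
  then show False
  proof cases
    case 1
    have "\<exists>m<1. 0 < m \<and> (\<forall>u. m < u \<and> u < 1 \<longrightarrow>
        T0 < integral {0..pi} (\<lambda>t. Phi c1 (u * (e ps * f t))))"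
    proof (rule Phi_integral_blowup)
      show "C2 (\<lambda>t. e ps * f t)" by (intro C2_mult C2_const fg)
      show "e ps * f t \<le> zmax c1" for t using f_rep[of t] le_f by auto
    qed (use 1 c psg in auto)
    then obtain m where m: "m < 1" "0 < m" "\<And>u. m < u \<Longrightarrow> u < 1 \<Longrightarrow>
        T0 < integral {0..pi} (\<lambda>t. Phi c1 (u * (e ps * f t)))" by blast
    have nz: "e ps \<noteq> 0" using 1 z by auto
    have "isCont e ps"
      using ce[of UNIV] by (simp add: continuous_on_eq_continuous_at)
    then have "(e \<longlongrightarrow> e ps) (at_left ps)"
      by (simp add: isCont_def filterlim_at_split)
    then have "((\<lambda>p. e p / e ps) \<longlongrightarrow> e ps / e ps) (at_left ps)"
      using nz by (intro tendsto_divide tendsto_const)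
    then have "eventually (\<lambda>p. m < e p / e ps) (at_left ps)"
      using nz m by (intro order_tendstoD) auto
    moreover have "eventually (\<lambda>p. 0 < p \<and> p < ps) (at_left ps)"
      using ps0 eventually_at_left_real by (auto elim: eventually_mono)
    ultimately have "eventually (\<lambda>p. m < e p / e ps \<and> 0 < p \<and> p < ps) (at_left ps)"
      by (rule eventually_conj)
    then obtain p where p: "m < e p / e ps" "0 < p" "p < ps"
      using eventually_happens'[OF trivial_limit_at_left_real] by blast
    \<comment> \<open>No monotonicity of \<open>e\<close> is assumed: the ratio is below 1 because
      the argument at \<open>t0\<close> is still subcritical for \<open>p < ps\<close>.\<close>
    have "e p / e ps * zmax c1 = e p * f t0" using 1 nz by (simp add: field_simps)
    also have "\<dots> < 1 * zmax c1" using less_f p psg by simp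
    finally have "e p / e ps < 1" by (rule mult_right_less_imp_less) (use z in simp)
    from m(3)[OF p(1) this] have "T0 < I1 p" using nz by (simp add: I1_def)
    then show False using le_T0(1)[of p] p by simp
  next
    case 2
    \<comment> \<open>Selects the end \<open>s * ps\<close> of the interval at which the argument at
      \<open>t0\<close> itself, and not only its absolute value, becomes critical. For
      \<open>s = -1\<close> this is the end reached only by continuation.\<close>
    define s where "s = sgn (g t0)"
    have s: "s = 1 \<or> s = -1" "s * g t0 = \<bar>g t0\<bar>"
      using 2 z by (auto simp: s_def sgn_if)
    have sj: "s ^ j = s" using s j by auto
    have "\<exists>m<1. 0 < m \<and> (\<forall>u. m < u \<and> u < 1 \<longrightarrow>
        T0 < integral {0..pi} (\<lambda>t. Phi c2 (u * (s * ps ^ j * g t))))"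
    proof (rule Phi_integral_blowup)
      show "C2 (\<lambda>t. s * ps ^ j * g t)" by (intro C2_mult C2_const fg)
      show "s * ps ^ j * g t \<le> zmax c2" for t
      proof -
        obtain t' where t': "t' \<in> {0..pi}" "\<bar>g t\<bar> = \<bar>g t'\<bar>" using g_rep by blast
        have "s * ps ^ j * g t \<le> \<bar>s * ps ^ j * g t\<bar>" by simp
        also have "\<dots> = \<bar>ps ^ j * g t'\<bar>" using s t' by (auto simp: abs_mult)
        finally show ?thesis using le_g[OF t'(1)] by simp
      qed
      have "s * ps ^ j * g t0 = ps ^ j * (s * g t0)" by simp
      also have "\<dots> = \<bar>ps ^ j * g t0\<bar>" unfolding s(2) using ps0 by (simp add: abs_mult)
      finally show "s * ps ^ j * g t0 = zmax c2" using 2 by simp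
    qed (use c psg in auto)
    then obtain m where m: "m < 1" "0 < m" "\<And>u. m < u \<Longrightarrow> u < 1 \<Longrightarrow>
        T0 < integral {0..pi} (\<lambda>t. Phi c2 (u * (s * ps ^ j * g t)))" by blast
    \<comment> \<open>Puts \<open>r ^ j\<close> at the midpoint of \<open>m\<close> and 1.\<close>
    define r where "r = root j ((m + 1) / 2)"
    have r: "r ^ j = (m + 1) / 2" "0 < r" "r < 1"
      using m j0 by (auto simp: r_def real_root_lt_1_iff)
    have eq: "r ^ j * (s * ps ^ j * g t) = (s * r * ps) ^ j * g t" for t
      by (simp add: power_mult_distrib sj)
    have "T0 < integral {0..pi} (\<lambda>t. Phi c2 (r ^ j * (s * ps ^ j * g t)))"
      by (rule m(3)) (use r m in auto)
    then have "T0 < I2 (s * r * ps)" by (simp only: eq I2_def)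
    moreover have "\<bar>s * r * ps\<bar> < ps" using s r ps0 by (auto simp: abs_mult)
    ultimately show False using le_T0(2)[of "s * r * ps"] by simp
  qed
qed

section \<open>Polar form of the upper arcs\<close>

text \<open>The gradient is supplied as a chain rule along curves relative to an arbitrary set:
  constant and identity curves give partial derivatives, trajectories give one-sided derivatives at
  their ends. Euler's identity later evaluates the angular speed.\<close>

lemma homogeneous_partials:
  assumes "homogeneous_poly2 d F"
  obtains Fx Fy where
    "\<And>x y x' y' t S. (x has_real_derivative x') (at t within S) \<Longrightarrow>
       (y has_real_derivative y') (at t within S) \<Longrightarrow>
       ((\<lambda>t. F (x t) (y t)) has_real_derivative Fx (x t) (y t) * x' + Fy (x t) (y t) * y') (at t within S)"
    "\<And>x y. x * Fx x y + y * Fy x y = real d * F x y"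
proof -
  obtain a where a: "\<And>x y. F x y = (\<Sum>i\<le>d. a i * x ^ (d - i) * y ^ i)"
    using assms unfolding homogeneous_poly2_def by blast
  define Fx where "Fx = (\<lambda>x y. \<Sum>i\<le>d. a i * (real (d - i) * x ^ (d - i - 1)) * y ^ i)"
  define Fy where "Fy = (\<lambda>x y. \<Sum>i\<le>d. a i * x ^ (d - i) * (real i * y ^ (i - 1)))"
  show ?thesis
  proof (rule that[of Fx Fy])
    fix x y :: "real \<Rightarrow> real" and x' y' t S
    assume D: "(x has_real_derivative x') (at t within S)" "(y has_real_derivative y') (at t within S)"
    have "((\<lambda>t. \<Sum>i\<le>d. a i * x t ^ (d - i) * y t ^ i) has_real_derivative
        (\<Sum>i\<le>d. a i * (real (d - i) * x t ^ (d - i - 1)) * y t ^ i * x'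
          + a i * x t ^ (d - i) * (real i * y t ^ (i - 1)) * y')) (at t within S)"
      by (rule DERIV_sum) (use D in \<open>auto intro!: derivative_eq_intros simp: algebra_simps\<close>)
    then show "((\<lambda>t. F (x t) (y t)) has_real_derivative Fx (x t) (y t) * x' + Fy (x t) (y t) * y')
        (at t within S)"
      by (simp add: a Fx_def Fy_def sum.distrib sum_distrib_right)
  next
    fix x y
    have pow: "z * (real k * z ^ (k - 1)) = real k * z ^ k" for z :: real and k
      by (cases k) auto
    have "x * (a i * (real (d - i) * x ^ (d - i - 1)) * y ^ i)
        + y * (a i * x ^ (d - i) * (real i * y ^ (i - 1))) = real d * (a i * x ^ (d - i) * y ^ i)"
      if "i \<le> d" for i
    proof -
      have "x * (a i * (real (d - i) * x ^ (d - i - 1)) * y ^ i)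
        + y * (a i * x ^ (d - i) * (real i * y ^ (i - 1)))
        = a i * (x * (real (d - i) * x ^ (d - i - 1))) * y ^ i
        + a i * x ^ (d - i) * (y * (real i * y ^ (i - 1)))" by (simp only: mult_ac)
      also have "\<dots> = real d * (a i * x ^ (d - i) * y ^ i)"
        unfolding pow using that by (simp add: of_nat_diff algebra_simps)
      finally show ?thesis .
    qed
    then show "x * Fx x y + y * Fy x y = real d * F x y"
      by (simp add: a Fx_def Fy_def sum_distrib_left flip: sum.distrib)
  qed
qed

lemma homogeneous_scale:
  assumes "homogeneous_poly2 d F" shows "F (r * x) (r * y) = r ^ d * F x y"
proof -
  obtain a where a: "\<And>x y. F x y = (\<Sum>i\<le>d. a i * x ^ (d - i) * y ^ i)"
    using assms unfolding homogeneous_poly2_def by blast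
  have "a i * (r * x) ^ (d - i) * (r * y) ^ i = r ^ d * (a i * x ^ (d - i) * y ^ i)" if "i \<le> d" for i
  proof -
    have "r ^ (d - i) * r ^ i = r ^ d" using that by (simp flip: power_add)
    then show ?thesis by (simp add: power_mult_distrib algebra_simps)
  qed
  then show ?thesis unfolding a sum_distrib_left by (intro sum.cong) simp_all
qed

lemma homogeneous_reflect:
  assumes "homogeneous_poly2 d F" shows "homogeneous_poly2 d (\<lambda>x y. F x (- y))"
proof -
  obtain a where a: "\<And>x y. F x y = (\<Sum>i\<le>d. a i * x ^ (d - i) * y ^ i)"
    using assms unfolding homogeneous_poly2_def by blast
  have "a i * x ^ (d - i) * (- y) ^ i = a i * (- 1) ^ i * x ^ (d - i) * y ^ i" for x y :: real and i
    by (subst power_minus) (simp only: mult_ac)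
  note eq = this
  show ?thesis
    unfolding homogeneous_poly2_def a
    by (intro exI[of _ "\<lambda>i. a i * (- 1) ^ i"] allI sum.cong refl eq)
qed

lemma homogeneous_bound:
  assumes "homogeneous_poly2 d F"
  obtains M where "M > 0" "\<And>x y r. x\<^sup>2 + y\<^sup>2 = r\<^sup>2 \<Longrightarrow> 0 \<le> r \<Longrightarrow> \<bar>F x y\<bar> \<le> M * r ^ d"
proof -
  obtain a where a: "\<And>x y. F x y = (\<Sum>i\<le>d. a i * x ^ (d - i) * y ^ i)"
    using assms unfolding homogeneous_poly2_def by blast
  show ?thesis
  proof (rule that[of "(\<Sum>i\<le>d. \<bar>a i\<bar>) + 1"])
    show "(\<Sum>i\<le>d. \<bar>a i\<bar>) + 1 > 0" by (simp add: sum_nonneg add_nonneg_pos)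
    fix x y r :: real assume r: "x\<^sup>2 + y\<^sup>2 = r\<^sup>2" "0 \<le> r"
    have "x\<^sup>2 \<le> r\<^sup>2" "y\<^sup>2 \<le> r\<^sup>2"
      using zero_le_power2[of x] zero_le_power2[of y] r(1) by linarith+
    then have xy: "\<bar>x\<bar> \<le> r" "\<bar>y\<bar> \<le> r"
      using r(2) by (simp_all flip: abs_le_square_iff)
    have "\<bar>a i * x ^ (d - i) * y ^ i\<bar> \<le> \<bar>a i\<bar> * r ^ d" if "i \<le> d" for i
    proof -
      have "\<bar>x\<bar> ^ (d - i) * \<bar>y\<bar> ^ i \<le> r ^ (d - i) * r ^ i"
        using xy by (intro mult_mono power_mono) (auto simp: r)
      also have "\<dots> = r ^ d" using that by (simp flip: power_add)
      finally have "\<bar>a i\<bar> * (\<bar>x\<bar> ^ (d - i) * \<bar>y\<bar> ^ i) \<le> \<bar>a i\<bar> * r ^ d"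
        by (intro mult_left_mono) auto
      then show ?thesis by (simp add: abs_mult power_abs mult.assoc)
    qed
    then have "\<bar>F x y\<bar> \<le> (\<Sum>i\<le>d. \<bar>a i\<bar> * r ^ d)"
      unfolding a by (intro order_trans[OF sum_abs] sum_mono) auto
    also have "\<dots> = (\<Sum>i\<le>d. \<bar>a i\<bar>) * r ^ d" by (simp add: sum_distrib_right)
    also have "\<dots> \<le> ((\<Sum>i\<le>d. \<bar>a i\<bar>) + 1) * r ^ d"
      using r by (intro mult_right_mono) auto
    finally show "\<bar>F x y\<bar> \<le> ((\<Sum>i\<le>d. \<bar>a i\<bar>) + 1) * r ^ d" .
  qed
qed

section \<open>Hamiltonian fields and their arcs\<close>

lemma hamiltonian_field_partials:
  assumes chain: "\<And>x y x' y' t S. (x has_real_derivative x') (at t within S) \<Longrightarrow>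
       (y has_real_derivative y') (at t within S) \<Longrightarrow>
       ((\<lambda>t. F (x t) (y t)) has_real_derivative Fx (x t) (y t) * x' + Fy (x t) (y t) * y') (at t within S)"
  shows "hamiltonian_field (\<lambda>x y. (x\<^sup>2 + y\<^sup>2) / 2 + F x y) (x, y) = (- (y + Fy x y), x + Fx x y)"
proof -
  have "((\<lambda>v. (x\<^sup>2 + v\<^sup>2) / 2 + F x v) has_real_derivative y + Fy x y) (at y)"
    using chain[OF DERIV_const[of x "at y"] DERIV_ident]
    by (auto intro!: derivative_eq_intros)
  moreover have "((\<lambda>u. (u\<^sup>2 + y\<^sup>2) / 2 + F u y) has_real_derivative x + Fx x y) (at x)"
    using chain[OF DERIV_ident DERIV_const[of y "at x"]]
    by (auto intro!: derivative_eq_intros)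
  ultimately show ?thesis
    by (simp add: hamiltonian_field_def DERIV_imp_deriv)
qed

lemma trajectory_on_components:
  assumes "trajectory_on X T \<gamma>" "t \<in> {0..T}"
  shows "((\<lambda>t. fst (\<gamma> t)) has_real_derivative fst (X (\<gamma> t))) (at t within {0..T})"
    and "((\<lambda>t. snd (\<gamma> t)) has_real_derivative snd (X (\<gamma> t))) (at t within {0..T})"
proof -
  have D: "(\<gamma> has_vector_derivative X (\<gamma> t)) (at t within {0..T})"
    using assms unfolding trajectory_on_def by blast
  show "((\<lambda>t. fst (\<gamma> t)) has_real_derivative fst (X (\<gamma> t))) (at t within {0..T})"
    using bounded_linear.has_vector_derivative[OF bounded_linear_fst D]
    by (simp add: has_real_derivative_iff_has_vector_derivative)
  show "((\<lambda>t. snd (\<gamma> t)) has_real_derivative snd (X (\<gamma> t))) (at t within {0..T})"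
    using bounded_linear.has_vector_derivative[OF bounded_linear_snd D]
    by (simp add: has_real_derivative_iff_has_vector_derivative)
qed

text \<open>The reflection \<open>y \<mapsto> - y\<close> reverses the sign of a Hamiltonian field,
  and time reversal restores it; the reversal also exchanges the endpoints, so the new arc starts at
  \<open>p\<close>.\<close>

lemma lower_arc_imp_upper_arc_reflect:
  assumes F: "homogeneous_poly2 d F"
    and "lower_arc (hamiltonian_field (\<lambda>x y. (x\<^sup>2 + y\<^sup>2) / 2 + F x y)) p q T"
  shows "upper_arc (hamiltonian_field (\<lambda>x y. (x\<^sup>2 + y\<^sup>2) / 2 + F x (- y))) p q T"
proof -
  let ?X = "hamiltonian_field (\<lambda>x y. (x\<^sup>2 + y\<^sup>2) / 2 + F x y)"
  let ?Y = "hamiltonian_field (\<lambda>x y. (x\<^sup>2 + y\<^sup>2) / 2 + F x (- y))"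
  obtain \<gamma> where \<gamma>: "trajectory_on ?X T \<gamma>" "\<gamma> 0 = (q, 0)" "\<gamma> T = (p, 0)"
      "\<And>t. t \<in> {0<..<T} \<Longrightarrow> snd (\<gamma> t) < 0" and T: "0 < T" "q < 0"
    using assms(2) unfolding lower_arc_def by blast
  obtain Fx Fy where chain: "\<And>x y x' y' t S. (x has_real_derivative x') (at t within S) \<Longrightarrow>
       (y has_real_derivative y') (at t within S) \<Longrightarrow>
       ((\<lambda>t. F (x t) (y t)) has_real_derivative Fx (x t) (y t) * x' + Fy (x t) (y t) * y') (at t within S)"
    by (rule homogeneous_partials[OF F]) (rule that, assumption)
  have X: "?X (x, y) = (- (y + Fy x y), x + Fx x y)" for x y
    by (rule hamiltonian_field_partials[OF chain])
  have Y: "?Y (x, y) = (- (y - Fy x (- y)), x + Fx x (- y))" for x y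
  proof -
    have "?Y (x, y) = (- (y + (- Fy x (- y))), x + Fx x (- y))"
    proof (rule hamiltonian_field_partials[where Fx = "\<lambda>x y. Fx x (- y)" and Fy = "\<lambda>x y. - Fy x (- y)"])
      fix x y :: "real \<Rightarrow> real" and x' y' t S
      assume "(x has_real_derivative x') (at t within S)" "(y has_real_derivative y') (at t within S)"
      from chain[OF this(1) DERIV_minus[OF this(2)]]
      show "((\<lambda>t. F (x t) (- y t)) has_real_derivative Fx (x t) (- y t) * x' + - Fy (x t) (- y t) * y')
        (at t within S)" by simp
    qed
    then show ?thesis by simp
  qed
  define \<delta> where "\<delta> = (\<lambda>t. (fst (\<gamma> (T - t)), - snd (\<gamma> (T - t))))"
  have "trajectory_on ?Y T \<delta>"
    unfolding trajectory_on_def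
  proof
    fix t assume t: "t \<in> {0..T}"
    have img: "(\<lambda>t. T - t) ` {0..T} = {0..T}" by simp
    have Tt: "T - t \<in> {0..T}" using t by auto
    note D = trajectory_on_components[OF \<gamma>(1) Tt]
    have r: "((\<lambda>t. T - t) has_real_derivative -1) (at t within {0..T})"
      by (auto intro!: derivative_eq_intros)
    have x: "((\<lambda>t. fst (\<gamma> (T - t))) has_real_derivative - fst (?X (\<gamma> (T - t)))) (at t within {0..T})"
      using DERIV_image_chain[OF _ r, unfolded img, OF D(1)] by (simp add: o_def)
    have y: "((\<lambda>t. snd (\<gamma> (T - t))) has_real_derivative - snd (?X (\<gamma> (T - t)))) (at t within {0..T})"
      using DERIV_image_chain[OF _ r, unfolded img, OF D(2)] by (simp add: o_def)
    have "(\<delta> has_vector_derivative (- fst (?X (\<gamma> (T - t))), snd (?X (\<gamma> (T - t))))) (at t within {0..T})"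
      unfolding \<delta>_def
      by (rule has_vector_derivative_Pair)
        (use x DERIV_minus[OF y] in \<open>simp_all add: has_real_derivative_iff_has_vector_derivative\<close>)
    moreover have "(- fst (?X (\<gamma> (T - t))), snd (?X (\<gamma> (T - t)))) = ?Y (\<delta> t)"
      by (cases "\<gamma> (T - t)") (simp add: X Y \<delta>_def)
    ultimately show "(\<delta> has_vector_derivative ?Y (\<delta> t)) (at t within {0..T})" by simp
  qed
  then show ?thesis
    unfolding upper_arc_def using T \<gamma>(2-4)
    by (intro conjI exI[of _ \<delta>]) (auto simp: \<delta>_def)
qed

text \<open>Energy conservation makes the radius, and hence \<open>dt / d\<theta>\<close>, a
  function of the angle alone. Small \<open>p\<close> confines the arc to \<open>r < 2 * p\<close>,
  where the angle increases and the arguments of \<open>Phi\<close> are subcritical. The formulas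
  for \<open>p\<close> and \<open>- q\<close> are the energy relation at the angles 0 and
  \<open>pi\<close>.\<close>

lemma upper_arc_period:
  assumes F: "homogeneous_poly2 (j + 2) F" and j: "j \<ge> 1"
    and H: "H = (\<lambda>x y. (x\<^sup>2 + y\<^sup>2) / 2 + F x y)"
  shows "\<exists>p0>0. \<forall>p q T s. 0 < p \<and> p < p0 \<and> upper_arc (hamiltonian_field H) p q T \<and>
      s = sqrt (2 * H p 0) \<longrightarrow> H q 0 = H p 0 \<and> 0 < H p 0 \<and>
      p = s * exp (beta_inv (real j / 2) (- 2 * s ^ j * F 1 0) / 2) \<and>
      - q = s * exp (beta_inv (real j / 2) (- 2 * s ^ j * F (- 1) 0) / 2) \<and>
      T = integral {0..pi} (\<lambda>t. Phi (real j / 2) (- 2 * s ^ j * F (cos t) (sin t)))"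
proof -
  define c where "c = real j / 2"
  have c: "c > 0" using j by (simp add: c_def)
  obtain Fx Fy where chain: "\<And>x y x' y' t S. (x has_real_derivative x') (at t within S) \<Longrightarrow>
       (y has_real_derivative y') (at t within S) \<Longrightarrow>
       ((\<lambda>t. F (x t) (y t)) has_real_derivative Fx (x t) (y t) * x' + Fy (x t) (y t) * y') (at t within S)"
    and euler: "\<And>x y. x * Fx x y + y * Fy x y = real (j + 2) * F x y"
    by (rule homogeneous_partials[OF F]) (rule that, assumption+)
  have X: "hamiltonian_field H (x, y) = (- (y + Fy x y), x + Fx x y)" for x y
    unfolding H by (rule hamiltonian_field_partials[OF chain])
  obtain M where M: "M > 0" "\<And>x y r. x\<^sup>2 + y\<^sup>2 = r\<^sup>2 \<Longrightarrow> 0 \<le> r \<Longrightarrow> \<bar>F x y\<bar> \<le> M * r ^ (j + 2)"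
    by (rule homogeneous_bound[OF F]) (rule that, assumption+)
  have z: "zmax c > 0" using c by (rule zmax_pos)
  \<comment> \<open>Dominates three constants at once: \<open>j + 2\<close> for positive angular
    speed, 4 for the confinement of the arc, and \<open>2 / zmax c\<close> for subcritical
    arguments.\<close>
  define L where "L = real j + 4 + 2 / zmax c"
  have L: "L > 0" "real j + 2 \<le> L" "4 \<le> L" "2 / zmax c \<le> L" using z by (auto simp: L_def add_pos_pos)
  define e where "e = 1 / (L * M + 1)"
  define p0 where "p0 = e / 2"
  have LM: "L * M > 0" using L M by simp
  have p0: "p0 > 0" using LM by (simp add: p0_def e_def)
  define f where "f = (\<lambda>t. F (cos t) (sin t))"
  have main: "H q 0 = H p 0 \<and> 0 < H p 0 \<and> p = s * exp (beta_inv c (- 2 * s ^ j * F 1 0) / 2) \<and>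
      - q = s * exp (beta_inv c (- 2 * s ^ j * F (- 1) 0) / 2) \<and>
      T = integral {0..pi} (\<lambda>t. Phi c (- 2 * s ^ j * f t))"
    if p: "0 < p" "p < p0" and arc: "upper_arc (hamiltonian_field H) p q T" and s: "s = sqrt (2 * H p 0)"
    for p q T s
  proof -
    obtain \<gamma> where \<gamma>: "trajectory_on (hamiltonian_field H) T \<gamma>" "\<gamma> 0 = (p, 0)" "\<gamma> T = (q, 0)"
        "\<And>t. t \<in> {0<..<T} \<Longrightarrow> snd (\<gamma> t) > 0" and T: "0 < T" "q < 0"
      using arc unfolding upper_arc_def by blast
    define w where "w = (2 * p) ^ j"
    have pe: "2 * p < e" using p(2) by (simp add: p0_def)
    have "e \<le> 1" "e * (L * M + 1) = 1" using LM by (simp_all add: e_def)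
    moreover have "2 * p * (L * M + 1) < e * (L * M + 1)"
      using pe LM by (intro mult_strict_right_mono) auto
    ultimately have p1: "2 * p \<le> 1" "2 * p * (L * M + 1) < 1"
      using pe by linarith+
    have w: "0 \<le> w" "w \<le> 2 * p"
      using p p1 j power_decreasing[of 1 j "2 * p"] by (auto simp: w_def)
    have LMw: "L * (M * w) < 1"
    proof -
      have "L * M * w \<le> L * M * (2 * p)" using LM w by (intro mult_left_mono) auto
      also have "\<dots> < 1" using p1 p by (simp add: algebra_simps)
      finally show ?thesis by (simp add: mult.assoc)
    qed
    have Mw0: "0 \<le> M * w" using M w by simp
    have Mw: "(real j + 2) * (M * w) < 1" "4 * (M * w) < 1" "2 * (M * w) < zmax c"
    proof -
      have *: "a * (M * w) < 1" if "a \<le> L" for a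
        using mult_right_mono[OF that Mw0] LMw by linarith
      show "(real j + 2) * (M * w) < 1" "4 * (M * w) < 1" by (rule *[OF L(2)], rule *[OF L(3)])
      have "2 / zmax c * (M * w) < 1" by (rule *[OF L(4)])
      then show "2 * (M * w) < zmax c" using z by (simp add: field_simps)
    qed
    define x y where "x = (\<lambda>t. fst (\<gamma> t))" and "y = (\<lambda>t. snd (\<gamma> t))"
    have \<gamma>xy: "\<gamma> t = (x t, y t)" for t by (simp add: x_def y_def)
    have dx: "(x has_real_derivative - (y t + Fy (x t) (y t))) (at t within {0..T})"
      and dy: "(y has_real_derivative x t + Fx (x t) (y t)) (at t within {0..T})"
      if "t \<in> {0..T}" for t
      using trajectory_on_components[OF \<gamma>(1) that] X by (simp_all add: \<gamma>xy)
    have cx: "continuous_on {0..T} x" and cy: "continuous_on {0..T} y"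
      by (auto simp: continuous_on_eq_continuous_within intro: DERIV_continuous[OF dx] DERIV_continuous[OF dy])
    have ends: "x 0 = p" "y 0 = 0" "x T = q" "y T = 0" using \<gamma> by (simp_all add: x_def y_def)
    have y_pos: "y t > 0" if "t \<in> {0<..<T}" for t using \<gamma>(4)[OF that] by (simp add: y_def)
    have y_nonneg: "y t \<ge> 0" if "t \<in> {0..T}" for t
      using y_pos[of t] ends that by (cases "t = 0 \<or> t = T") (auto simp: less_imp_le)
    have "\<exists>k. \<forall>t\<in>{0..T}. H (x t) (y t) = k"
    proof (rule has_field_derivative_zero_constant)
      fix t assume t: "t \<in> {0..T}"
      show "((\<lambda>t. H (x t) (y t)) has_real_derivative 0) (at t within {0..T})"
      proof -
        have "((\<lambda>t. ((x t)\<^sup>2 + (y t)\<^sup>2) / 2) has_real_derivative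
            x t * (- (y t + Fy (x t) (y t))) + y t * (x t + Fx (x t) (y t))) (at t within {0..T})"
          using dx[OF t] dy[OF t] by (auto intro!: derivative_eq_intros simp: field_simps)
        from DERIV_add[OF this chain[OF dx[OF t] dy[OF t]]] show ?thesis
          by (simp add: H algebra_simps)
      qed
    qed auto
    then have energy: "H (x t) (y t) = H p 0" if "t \<in> {0..T}" for t
      using that T ends by (metis atLeastAtMost_iff less_eq_real_def)
    define h where "h = H p 0"
    have Fp: "\<bar>F p 0\<bar> \<le> M * w * p\<^sup>2"
    proof -
      have "\<bar>F p 0\<bar> \<le> M * p ^ (j + 2)" using p by (intro M) auto
      also have "\<dots> = M * p ^ j * p\<^sup>2" by (simp add: power_add power2_eq_square)
      also have "\<dots> \<le> M * w * p\<^sup>2"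
        unfolding w_def using M p by (intro mult_right_mono mult_left_mono power_mono) auto
      finally show ?thesis .
    qed
    have p2: "p\<^sup>2 > 0" using p by simp
    have "4 * (M * w) * p\<^sup>2 \<le> 1 * p\<^sup>2" using Mw p2 by (intro mult_right_mono) auto
    then have Fp': "\<bar>F p 0\<bar> \<le> p\<^sup>2 / 4" using Fp by linarith
    have h: "h > 0" "h \<le> 3 / 4 * p\<^sup>2"
    proof -
      have "h = p\<^sup>2 / 2 + F p 0" by (simp add: h_def H)
      then show "h > 0" "h \<le> 3 / 4 * p\<^sup>2" using Fp' p2 by linarith+
    qed
    define r where "r = (\<lambda>t. sqrt ((x t)\<^sup>2 + (y t)\<^sup>2))"
    have r2: "(x t)\<^sup>2 + (y t)\<^sup>2 = (r t)\<^sup>2" and r0: "r t \<ge> 0" for t by (simp_all add: r_def)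
    have cr: "continuous_on {0..T} r" unfolding r_def by (intro continuous_intros cx cy)
    have r_ends: "r 0 = p" "r T = - q" using p T by (simp_all add: r_def ends)
    \<comment> \<open>At a first exit with \<open>r u = 2 * p\<close> the energy would be at least
      \<open>p ^ 2\<close>, but it is at most \<open>3 / 4 * p ^ 2\<close>.\<close>
    have r_less: "r t < 2 * p" if t: "t \<in> {0..T}" for t
    proof (rule ccontr)
      assume "\<not> r t < 2 * p"
      then have "\<exists>u\<ge>0. u \<le> t \<and> r u = 2 * p"
        using t p r_ends by (intro IVT') (auto intro!: continuous_on_subset[OF cr])
      then obtain u where u: "0 \<le> u" "u \<le> t" "r u = 2 * p" by blast
      have "\<bar>F (x u) (y u)\<bar> \<le> M * (2 * p) ^ (j + 2)"
        using M(2)[OF r2[of u] r0] u by simp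
      also have "\<dots> = 4 * (M * w) * p\<^sup>2" by (simp add: w_def power_add power2_eq_square)
      also have "\<dots> \<le> 1 * p\<^sup>2" using Mw p2 by (intro mult_right_mono) auto
      finally have "\<bar>F (x u) (y u)\<bar> \<le> p\<^sup>2" by simp
      moreover have "H (x u) (y u) = 2 * p\<^sup>2 + F (x u) (y u)"
        using u r2[of u] by (simp add: H power_mult_distrib)
      moreover have "H (x u) (y u) = h" unfolding h_def by (rule energy) (use u t in auto)
      ultimately show False using h(2) p2 by linarith
    qed
    have r_pos: "r t > 0" if t: "t \<in> {0..T}" for t
    proof (rule ccontr)
      assume "\<not> r t > 0"
      then have "r t = 0" using r0[of t] by simp
      then have "x t = 0" "y t = 0" "F (x t) (y t) = 0"
        using r2[of t] M(2)[OF r2[of t] r0] by simp_all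
      then have "H (x t) (y t) = 0" by (simp add: H)
      then show False using energy[OF t] h(1) by (simp add: h_def)
    qed
    have s2: "s\<^sup>2 = 2 * h" and s_pos: "s > 0" using h by (simp_all add: s h_def)
    have s_le: "s \<le> 2 * p" 
    proof (rule power2_le_imp_le)
      have "s\<^sup>2 \<le> 4 * p\<^sup>2" using h s2 p2 by linarith
      then show "s\<^sup>2 \<le> (2 * p)\<^sup>2" by (simp add: power_mult_distrib)
    qed (use p in simp)
    \<comment> \<open>Since \<open>y \<ge> 0\<close> along the arc, \<open>arccos\<close> gives the
      polar angle without a choice of branch.\<close>
    define \<theta> where "\<theta> = (\<lambda>t. arccos (x t / r t))"
    have xr: "\<bar>x t / r t\<bar> \<le> 1" if t: "t \<in> {0..T}" for t
    proof -
      have "\<bar>x t\<bar> \<le> r t" unfolding r_def by simp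
      then show ?thesis using r_pos[OF t] by simp
    qed
    have one: "1 - (x t / r t)\<^sup>2 = (y t / r t)\<^sup>2" if t: "t \<in> {0..T}" for t
    proof -
      have "(x t / r t)\<^sup>2 + (y t / r t)\<^sup>2 = ((x t)\<^sup>2 + (y t)\<^sup>2) / (r t)\<^sup>2"
        by (simp add: power_divide add_divide_distrib)
      then show ?thesis unfolding r2 using r_pos[OF t] by simp
    qed
    have sq: "sqrt (1 - (x t / r t)\<^sup>2) = y t / r t" if t: "t \<in> {0..T}" for t
      unfolding one[OF t] using r_pos[OF t] y_nonneg[OF t] by simp
    have cos\<theta>: "cos (\<theta> t) = x t / r t" and sin\<theta>: "sin (\<theta> t) = y t / r t" if t: "t \<in> {0..T}" for t
      using cos_arccos_abs[OF xr[OF t]] sin_arccos_abs[OF xr[OF t]] sq[OF t] by (simp_all add: \<theta>_def)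
    have \<theta>_range: "\<theta> t \<in> {0..pi}" if t: "t \<in> {0..T}" for t
    proof -
      have "- 1 \<le> x t / r t" "x t / r t \<le> 1" using xr[OF t] by linarith+
      then show ?thesis using arccos_bounded[of "x t / r t"] by (simp add: \<theta>_def)
    qed
    have Ff: "F (x t) (y t) = r t ^ (j + 2) * f (\<theta> t)" if t: "t \<in> {0..T}" for t
    proof -
      have "F (r t * cos (\<theta> t)) (r t * sin (\<theta> t)) = r t ^ (j + 2) * f (\<theta> t)"
        unfolding f_def by (rule homogeneous_scale[OF F])
      then show ?thesis using r_pos[OF t] cos\<theta>[OF t] sin\<theta>[OF t] by simp
    qed
    have f_le: "\<bar>f t\<bar> \<le> M" for t using M(2)[of "cos t" "sin t" 1] by (simp add: f_def)
    define g where "g = (\<lambda>t. r t ^ j * f (\<theta> t))"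
    have Fg: "F (x t) (y t) = (r t)\<^sup>2 * g t" if t: "t \<in> {0..T}" for t
      unfolding Ff[OF t] by (simp add: g_def power_add power2_eq_square)
    have en: "s\<^sup>2 = (r t)\<^sup>2 * (1 + 2 * g t)" if t: "t \<in> {0..T}" for t
    proof -
      have "h = (r t)\<^sup>2 / 2 + (r t)\<^sup>2 * g t"
        using energy[OF t] r2[of t] Fg[OF t] by (simp add: h_def H)
      then show ?thesis by (simp add: s2 algebra_simps)
    qed
    have g_pos: "1 + real (j + 2) * g t > 0" if t: "t \<in> {0..T}" for t
    proof -
      have "\<bar>g t\<bar> \<le> w * M"
        unfolding g_def w_def abs_mult
      proof (rule mult_mono)
        show "\<bar>r t ^ j\<bar> \<le> (2 * p) ^ j"
          unfolding power_abs using r_less[OF t] r0[of t] by (intro power_mono) auto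
      qed (use f_le p in auto)
      then have "real (j + 2) * \<bar>g t\<bar> \<le> real (j + 2) * (M * w)"
        by (intro mult_left_mono) (auto simp: mult.commute)
      moreover have "real (j + 2) * (M * w) < 1" using Mw(1) by (simp add: add.commute)
      moreover have "- (real (j + 2) * \<bar>g t\<bar>) \<le> real (j + 2) * g t"
        using abs_ge_minus_self[of "real (j + 2) * g t"] by (simp add: abs_mult)
      ultimately show ?thesis by linarith
    qed
    \<comment> \<open>The value \<open>2 * ln (r t / s)\<close> solves the energy relation;
      \<open>g_pos\<close> places it on the increasing branch.\<close>
    have Vr: "beta_inv c (- 2 * s ^ j * f (\<theta> t)) = 2 * ln (r t / s)" if t: "t \<in> {0..T}" for t
    proof (rule beta_inv_eqI[OF c])
      have rs: "r t / s > 0" using r_pos[OF t] s_pos by simp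
      have ex: "exp (2 * ln (r t / s)) = (r t)\<^sup>2 / s\<^sup>2"
        using rs by (simp add: exp_double power_divide)
      have "c * (r t)\<^sup>2 < (c + 1) * s\<^sup>2"
      proof -
        have "(c + 1) * s\<^sup>2 - c * (r t)\<^sup>2 = (r t)\<^sup>2 * (1 + real (j + 2) * g t)"
          unfolding en[OF t] by (simp add: c_def field_simps)
        moreover have "\<dots> > 0" using r_pos[OF t] g_pos[OF t] by simp
        ultimately show ?thesis by linarith
      qed
      then show "2 * ln (r t / s) < vmax c"
        unfolding vmax_iff[OF c] ex using s_pos by (simp add: field_simps)
      have e1: "exp (- (c * (2 * ln (r t / s)))) = (s / r t) ^ j"
      proof -
        have "- (c * (2 * ln (r t / s))) = real j * ln (s / r t)"
          using r_pos[OF t] s_pos by (simp add: c_def ln_div field_simps)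
        then show ?thesis using r_pos[OF t] s_pos by (simp add: exp_of_nat_mult)
      qed
      have e2: "exp (- ((c + 1) * (2 * ln (r t / s)))) = (s / r t) ^ (j + 2)"
      proof -
        have "- ((c + 1) * (2 * ln (r t / s))) = real (j + 2) * ln (s / r t)"
          using r_pos[OF t] s_pos by (simp add: c_def ln_div field_simps)
        then show ?thesis using r_pos[OF t] s_pos by (simp only: exp_of_nat_mult) simp
      qed
      have "beta c (2 * ln (r t / s)) = (s / r t) ^ j - (s / r t) ^ (j + 2)"
        using e1 e2 by (simp add: beta_def)
      also have "\<dots> = (s / r t) ^ j * (1 - s\<^sup>2 / (r t)\<^sup>2)"
        by (simp add: power_add power_divide algebra_simps power2_eq_square)
      also have "1 - s\<^sup>2 / (r t)\<^sup>2 = - 2 * g t"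
        unfolding en[OF t] using r_pos[OF t] by simp
      also have "(s / r t) ^ j * (- 2 * g t) = - 2 * s ^ j * f (\<theta> t)"
        using r_pos[OF t] by (simp add: g_def power_divide)
      finally show "beta c (2 * ln (r t / s)) = - 2 * s ^ j * f (\<theta> t)" .
    qed
    have r_eq: "r t = s * exp (beta_inv c (- 2 * s ^ j * f (\<theta> t)) / 2)" if t: "t \<in> {0..T}" for t
      unfolding Vr[OF t] using r_pos[OF t] s_pos by simp
    have Phi_eq: "Phi c (- 2 * s ^ j * f (\<theta> t)) = 1 / (1 + real (j + 2) * g t)" if t: "t \<in> {0..T}" for t
    proof -
      have ex: "exp (2 * ln (r t / s)) = (r t)\<^sup>2 / s\<^sup>2"
        using r_pos[OF t] s_pos by (simp add: exp_double power_divide)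
      have "Phi c (- 2 * s ^ j * f (\<theta> t)) = (r t)\<^sup>2 / ((c + 1) * s\<^sup>2 - c * (r t)\<^sup>2)"
        unfolding Phi_def Vr[OF t] ex using s_pos by (simp add: field_simps)
      also have "(c + 1) * s\<^sup>2 - c * (r t)\<^sup>2 = (r t)\<^sup>2 * (1 + real (j + 2) * g t)"
        unfolding en[OF t] by (simp add: c_def field_simps)
      finally show ?thesis using r_pos[OF t] by simp
    qed
    define \<Psi> where "\<Psi> = (\<lambda>t. Phi c (- 2 * s ^ j * f t))"
    have cf: "continuous_on {0..pi} f"
    proof -
      have "(f has_real_derivative Fx (cos t) (sin t) * (- sin t) + Fy (cos t) (sin t) * cos t) (at t)" for t
        unfolding f_def by (rule chain[OF DERIV_cos DERIV_sin])
      then show ?thesis by (meson DERIV_isCont continuous_at_imp_continuous_on)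
    qed
    have c\<Psi>: "continuous_on {0..pi} \<Psi>"
      unfolding \<Psi>_def
    proof (intro continuous_on_Phi_compose c continuous_intros cf)
      fix t
      have "- 2 * s ^ j * f t \<le> 2 * s ^ j * \<bar>f t\<bar>"
        using s_pos mult_left_mono[of "- f t" "\<bar>f t\<bar>" "2 * s ^ j"] by simp
      also have "\<dots> \<le> 2 * w * M"
        unfolding w_def using s_pos s_le f_le M by (intro mult_mono power_mono) auto
      also have "\<dots> < zmax c" using Mw(3) by (simp add: mult_ac)
      finally show "- 2 * s ^ j * f t < zmax c" .
    qed
    have d\<theta>: "(\<theta> has_real_derivative 1 + real (j + 2) * g t) (at t)" if t: "t \<in> {0<..<T}" for t
    proof -
      have t': "t \<in> {0..T}" using t by auto
      have at: "at t within {0..T} = at t" using t by (intro at_within_interior) simp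
      define x' y' where "x' = - (y t + Fy (x t) (y t))" and "y' = x t + Fx (x t) (y t)"
      have D: "(x has_real_derivative x') (at t)" "(y has_real_derivative y') (at t)"
        using dx[OF t', unfolded at] dy[OF t', unfolded at] by (simp_all only: x'_def y'_def)
      have rp: "r t > 0" and yp: "y t > 0" using r_pos[OF t'] y_pos[OF t] by auto
      have "(r has_real_derivative (x t * x' + y t * y') / r t) (at t)"
      proof -
        have d1: "((\<lambda>t. (x t)\<^sup>2 + (y t)\<^sup>2) has_real_derivative 2 * (x t * x' + y t * y')) (at t)"
          using D by (auto intro!: derivative_eq_intros)
        have d2: "(sqrt has_real_derivative inverse (r t) / 2) (at ((x t)\<^sup>2 + (y t)\<^sup>2))"
          unfolding r_def by (rule DERIV_real_sqrt) (use rp r2[of t] in simp)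
        have "(r has_real_derivative inverse (r t) / 2 * (2 * (x t * x' + y t * y'))) (at t)"
          using DERIV_chain2[OF d2 d1] by (simp only: r_def)
        moreover have "inverse (r t) / 2 * (2 * a) = a / r t" for a by (simp add: inverse_eq_divide)
        ultimately show ?thesis by (simp only:)
      qed
      then have du': "((\<lambda>t. x t / r t) has_real_derivative
          (x' * r t - x t * ((x t * x' + y t * y') / r t)) / (r t * r t)) (at t)"
        using D(1) rp by (intro DERIV_divide) auto
      have quot: "(a * \<rho> - b * (A / \<rho>)) / (\<rho> * \<rho>) = (a * \<rho>\<^sup>2 - b * A) / \<rho> ^ 3"
        if "\<rho> \<noteq> 0" for a b A \<rho> :: real
        using that by (simp add: divide_simps power2_eq_square power3_eq_cube algebra_simps)
      have quot': "inverse (- (a / \<rho>)) * (a * B / \<rho> ^ 3) = - B / \<rho>\<^sup>2"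
        if "a \<noteq> 0" "\<rho> \<noteq> 0" for a B \<rho> :: real
        using that by (simp add: divide_simps power2_eq_square power3_eq_cube)
      have "(x' * r t - x t * ((x t * x' + y t * y') / r t)) / (r t * r t)
          = y t * (x' * y t - x t * y') / (r t) ^ 3"
      proof -
        have "(x' * r t - x t * ((x t * x' + y t * y') / r t)) / (r t * r t)
          = (x' * (r t)\<^sup>2 - x t * (x t * x' + y t * y')) / (r t) ^ 3"
          by (rule quot) (use rp in simp)
        also have "x' * (r t)\<^sup>2 - x t * (x t * x' + y t * y') = y t * (x' * y t - x t * y')"
          unfolding r2[symmetric] by (simp add: algebra_simps power2_eq_square)
        finally show ?thesis .
      qed
      with du' have du: "((\<lambda>t. x t / r t) has_real_derivative y t * (x' * y t - x t * y') / (r t) ^ 3) (at t)"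
        by (simp only:)
      have "0 < (y t / r t)\<^sup>2" using rp yp by simp
      then have "(x t / r t)\<^sup>2 < 1" using one[OF t'] by linarith
      then have "\<bar>x t / r t\<bar> < 1" by (simp only: abs_square_less_1)
      then have "(\<theta> has_real_derivative inverse (- sqrt (1 - (x t / r t)\<^sup>2)) *
          (y t * (x' * y t - x t * y') / (r t) ^ 3)) (at t)"
        unfolding \<theta>_def by (intro DERIV_chain2[OF DERIV_arccos du]) linarith+
      also have "inverse (- sqrt (1 - (x t / r t)\<^sup>2)) * (y t * (x' * y t - x t * y') / (r t) ^ 3)
          = (x t * y' - y t * x') / (r t)\<^sup>2"
        unfolding sq[OF t'] using rp yp by (subst quot') (auto simp: algebra_simps)
      \<comment> \<open>Euler's identity converts the radial derivative of the form into
        \<open>j + 2\<close> times the form.\<close>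
      also have "x t * y' - y t * x' = (r t)\<^sup>2 + real (j + 2) * F (x t) (y t)"
        unfolding x'_def y'_def r2[symmetric] euler[symmetric]
        by (simp add: algebra_simps power2_eq_square)
      also have "\<dots> / (r t)\<^sup>2 = 1 + real (j + 2) * g t"
        unfolding Fg[OF t'] using rp by (simp add: add_divide_distrib)
      finally show ?thesis .
    qed
    define G where "G = (\<lambda>u. integral {0..u} \<Psi>)"
    \<comment> \<open>\<open>G\<close> turns the angle into elapsed time. The derivative of
      \<open>arccos\<close> is singular where \<open>y = 0\<close>, so only continuity is used at
      the two ends.\<close>
    have "G (\<theta> T) - T = G (\<theta> 0) - 0"
    proof (rule DERIV_isconst_end[OF T(1)])
      have cG: "continuous_on {0..pi} G"
        unfolding G_def by (intro indefinite_integral_continuous_1 integrable_continuous_real c\<Psi>)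
      have c\<theta>: "continuous_on {0..T} \<theta>"
        unfolding \<theta>_def
        by (intro continuous_on_arccos continuous_on_divide cx cr)
          (use r_pos xr in \<open>fastforce simp only: abs_le_iff minus_le_iff\<close>)+
      show "continuous_on {0..T} (\<lambda>t. G (\<theta> t) - t)"
        by (intro continuous_on_diff continuous_on_compose2[OF cG c\<theta>] continuous_on_id)
          (use \<theta>_range in blast)
      fix t assume t: "0 < t" "t < T"
      then have t': "t \<in> {0..T}" "t \<in> {0<..<T}" by auto
      have "sin (\<theta> t) > 0" using sin\<theta>[OF t'(1)] r_pos[OF t'(1)] y_pos[OF t'(2)] by simp
      then have "\<theta> t \<noteq> 0" "\<theta> t \<noteq> pi" by auto
      then have in': "\<theta> t \<in> {0<..<pi}" using \<theta>_range[OF t'(1)] by auto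
      have "(G has_real_derivative \<Psi> (\<theta> t)) (at (\<theta> t) within {0..pi})"
        unfolding G_def by (rule integral_has_real_derivative[OF c\<Psi> \<theta>_range[OF t'(1)]])
      moreover have "at (\<theta> t) within {0..pi} = at (\<theta> t)" using in' by (intro at_within_interior) simp
      ultimately have "(G has_real_derivative \<Psi> (\<theta> t)) (at (\<theta> t))" by simp
      note dG = DERIV_chain2[OF this d\<theta>[OF t'(2)]]
      have "\<Psi> (\<theta> t) * (1 + real (j + 2) * g t) = 1"
        unfolding \<Psi>_def Phi_eq[OF t'(1)] using g_pos[OF t'(1)] by simp
      with dG have "((\<lambda>t. G (\<theta> t)) has_real_derivative 1) (at t)" by (simp only:)
      then show "((\<lambda>t. G (\<theta> t) - t) has_real_derivative 0) (at t)"
        by (auto intro!: derivative_eq_intros)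
    qed
    moreover have \<theta>0: "\<theta> 0 = 0" and \<theta>T: "\<theta> T = pi"
      using p T by (simp_all add: \<theta>_def ends r_ends)
    ultimately have "T = integral {0..pi} \<Psi>" by (simp add: G_def)
    moreover have "H q 0 = H p 0" using energy[of T] T ends by simp
    moreover have "p = s * exp (beta_inv c (- 2 * s ^ j * F 1 0) / 2)"
      using r_eq[of 0] T unfolding r_ends \<theta>0 by (simp add: f_def)
    moreover have "- q = s * exp (beta_inv c (- 2 * s ^ j * F (- 1) 0) / 2)"
      using r_eq[of T] T unfolding r_ends \<theta>T by (simp add: f_def)
    ultimately show ?thesis using h(1) unfolding \<Psi>_def h_def by blast
  qed
  show ?thesis
    using p0 main unfolding c_def f_def by (intro exI[of _ p0]) blast
qed

section \<open>Linear fields and the theorem\<close>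

text \<open>Each point of the circle or its antipode lies in the closed upper half. So a form takes
  all its values on the half circle when its degree is even, and does so up to sign when it is
  odd.\<close>

lemma cos_sin_upper_half:
  "\<exists>s\<in>{0..pi}. \<exists>\<sigma>\<in>{1, -1}. cos t = \<sigma> * cos s \<and> sin t = \<sigma> * sin s"
proof -
  define \<sigma> :: real where "\<sigma> = (if 0 \<le> sin t then 1 else -1)"
  define s where "s = arccos (\<sigma> * cos t)"
  have b: "\<bar>\<sigma> * cos t\<bar> \<le> 1" by (simp add: \<sigma>_def)
  have "cos s = \<sigma> * cos t" unfolding s_def by (rule cos_arccos_abs[OF b])
  moreover have "sin s = \<sigma> * sin t"
  proof -
    have "1 - (\<sigma> * cos t)\<^sup>2 = (sin t)\<^sup>2" by (simp add: \<sigma>_def cos_squared_eq)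
    then show ?thesis using sin_arccos_abs[OF b] by (simp add: s_def \<sigma>_def)
  qed
  moreover have "s \<in> {0..pi}"
    unfolding s_def using b by (intro arccos_lbound arccos_ubound atLeastAtMost_iff[THEN iffD2] conjI) linarith+
  moreover have "\<sigma> \<in> {1, -1}" by (simp add: \<sigma>_def)
  ultimately show ?thesis by (intro bexI[of _ s] bexI[of _ \<sigma>]) (auto simp: \<sigma>_def)
qed

lemma homogeneous_trig_rep:
  assumes "homogeneous_poly2 d F"
  shows "\<exists>s\<in>{0..pi}. \<exists>\<sigma>\<in>{1, -1}. F (cos t) (sin t) = \<sigma> ^ d * F (cos s) (sin s)"
proof -
  obtain s \<sigma> where "s \<in> {0..pi}" "\<sigma> \<in> {1, -1}" "cos t = \<sigma> * cos s" "sin t = \<sigma> * sin s"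
    using cos_sin_upper_half by blast
  then show ?thesis using homogeneous_scale[OF assms, of \<sigma> "cos s" "sin s"] by auto
qed

lemma C2_homogeneous_trig:
  assumes "homogeneous_poly2 d F" shows "C2 (\<lambda>t. F (cos t) (sin t))"
proof -
  obtain a where "\<And>x y. F x y = (\<Sum>i\<le>d. a i * x ^ (d - i) * y ^ i)"
    using assms unfolding homogeneous_poly2_def by blast
  then show ?thesis
    by (simp add: C2_sum C2_mult C2_const C2_power C2_cos C2_sin)
qed

text \<open>For \<open>n = 1\<close> the upper field is linear and \<open>c = 0\<close> is not covered by \<open>Phi\<close>; scaling of
  trajectories shows directly that the time of the upper arcs is constant.\<close>

lemma upper_arc_linear_scale:
  assumes F: "homogeneous_poly2 2 F"
    and arc: "upper_arc (hamiltonian_field (\<lambda>x y. (x\<^sup>2 + y\<^sup>2) / 2 + F x y)) p q T" and r: "r > 0"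
  shows "upper_arc (hamiltonian_field (\<lambda>x y. (x\<^sup>2 + y\<^sup>2) / 2 + F x y)) (r * p) (r * q) T"
proof -
  let ?X = "hamiltonian_field (\<lambda>x y. (x\<^sup>2 + y\<^sup>2) / 2 + F x y)"
  obtain a where a: "\<And>x y. F x y = (\<Sum>i\<le>2. a i * x ^ (2 - i) * y ^ i)"
    using F unfolding homogeneous_poly2_def by blast
  have F': "F x y = a 0 * x\<^sup>2 + a 1 * x * y + a 2 * y\<^sup>2" for x y
    by (simp add: a numeral_2_eq_2)
  have X: "?X (x, y) = (- (y + (a 1 * x + 2 * a 2 * y)), x + (2 * a 0 * x + a 1 * y))" for x y
    by (rule hamiltonian_field_partials[where Fx = "\<lambda>x y. 2 * a 0 * x + a 1 * y"
          and Fy = "\<lambda>x y. a 1 * x + 2 * a 2 * y"])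
      (unfold F', auto intro!: derivative_eq_intros simp: algebra_simps)
  have lin: "?X (r *\<^sub>R v) = r *\<^sub>R ?X v" for v
  proof (cases v)
    case (Pair x y)
    have "?X (r * x, r * y) = r *\<^sub>R ?X (x, y)" unfolding X by (simp add: algebra_simps)
    then show ?thesis by (simp only: Pair scaleR_Pair real_scaleR_def)
  qed
  obtain \<gamma> where \<gamma>: "trajectory_on ?X T \<gamma>" "\<gamma> 0 = (p, 0)" "\<gamma> T = (q, 0)"
      "\<And>t. t \<in> {0<..<T} \<Longrightarrow> snd (\<gamma> t) > 0" and T: "0 < T" "q < 0"
    using arc unfolding upper_arc_def by blast
  have "trajectory_on ?X T (\<lambda>t. r *\<^sub>R \<gamma> t)"
    using \<gamma>(1) unfolding trajectory_on_def lin
    by (auto intro: bounded_linear.has_vector_derivative[OF bounded_linear_scaleR_right])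
  then show ?thesis
    unfolding upper_arc_def using T \<gamma> r
    by (intro conjI exI[of _ "\<lambda>t. r *\<^sub>R \<gamma> t"]) (auto simp: mult_pos_neg)
qed

text \<open>On the axis the conserved quadratic form reduces to \<open>b * x ^ 2\<close>, which
  determines \<open>q\<close> up to sign unless \<open>b = 0\<close>.\<close>

lemma upper_arc_linear_endpoint:
  assumes F: "homogeneous_poly2 2 F"
    and arc: "upper_arc (hamiltonian_field (\<lambda>x y. (x\<^sup>2 + y\<^sup>2) / 2 + F x y)) p q T" and p: "p > 0"
  shows "q = - p"
proof -
  let ?X = "hamiltonian_field (\<lambda>x y. (x\<^sup>2 + y\<^sup>2) / 2 + F x y)"
  obtain a where a: "\<And>x y. F x y = (\<Sum>i\<le>2. a i * x ^ (2 - i) * y ^ i)"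
    using F unfolding homogeneous_poly2_def by blast
  have F': "F x y = a 0 * x\<^sup>2 + a 1 * x * y + a 2 * y\<^sup>2" for x y
    by (simp add: a numeral_2_eq_2)
  have X: "?X (x, y) = (- (y + (a 1 * x + 2 * a 2 * y)), x + (2 * a 0 * x + a 1 * y))" for x y
    by (rule hamiltonian_field_partials[where Fx = "\<lambda>x y. 2 * a 0 * x + a 1 * y"
          and Fy = "\<lambda>x y. a 1 * x + 2 * a 2 * y"])
      (unfold F', auto intro!: derivative_eq_intros simp: algebra_simps)
  obtain \<gamma> where \<gamma>: "trajectory_on ?X T \<gamma>" "\<gamma> 0 = (p, 0)" "\<gamma> T = (q, 0)"
      "\<And>t. t \<in> {0<..<T} \<Longrightarrow> snd (\<gamma> t) > 0" and T: "0 < T" "q < 0"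
    using arc unfolding upper_arc_def by blast
  define x y where "x = (\<lambda>t. fst (\<gamma> t))" and "y = (\<lambda>t. snd (\<gamma> t))"
  have \<gamma>xy: "\<gamma> t = (x t, y t)" for t by (simp add: x_def y_def)
  have dx: "(x has_real_derivative - (y t + (a 1 * x t + 2 * a 2 * y t))) (at t within {0..T})"
    and dy: "(y has_real_derivative x t + (2 * a 0 * x t + a 1 * y t)) (at t within {0..T})"
    if "t \<in> {0..T}" for t
    using trajectory_on_components[OF \<gamma>(1) that] X by (simp_all add: \<gamma>xy)
  have ends: "x 0 = p" "y 0 = 0" "x T = q" "y T = 0" using \<gamma> by (simp_all add: x_def y_def)
  have T_in: "0 \<in> {0..T}" "T \<in> {0..T}" "T / 2 \<in> {0..T}" using T by auto
  define b where "b = 1 + 2 * a 0"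
  have "\<exists>k. \<forall>t\<in>{0..T}. b * (x t)\<^sup>2 + 2 * a 1 * (x t * y t) + (1 + 2 * a 2) * (y t)\<^sup>2 = k"
  proof (rule has_field_derivative_zero_constant)
    fix t assume t: "t \<in> {0..T}"
    show "((\<lambda>t. b * (x t)\<^sup>2 + 2 * a 1 * (x t * y t) + (1 + 2 * a 2) * (y t)\<^sup>2) has_real_derivative 0)
        (at t within {0..T})"
      using dx[OF t] dy[OF t]
      by (auto intro!: derivative_eq_intros simp: b_def algebra_simps power2_eq_square)
  qed auto
  then have "b * p\<^sup>2 = b * q\<^sup>2" using T_in ends by (metis add.right_neutral mult_zero_right power_zero_numeral)
  \<comment> \<open>For \<open>b = 0\<close> the equation for \<open>y\<close> decouples to
    \<open>y' = a 1 * y\<close>, and an arc starting on the axis would never leave it.\<close>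
  moreover have "b \<noteq> 0"
  proof
    assume "b = 0"
    then have a0: "2 * a 0 = - 1" by (simp add: b_def)
    have "\<exists>k. \<forall>t\<in>{0..T}. y t * exp (- (a 1 * t)) = k"
    proof (rule has_field_derivative_zero_constant)
      fix t assume t: "t \<in> {0..T}"
      have "(y has_real_derivative a 1 * y t) (at t within {0..T})" using dy[OF t] by (simp add: a0)
      then show "((\<lambda>t. y t * exp (- (a 1 * t))) has_real_derivative 0) (at t within {0..T})"
        by (auto intro!: derivative_eq_intros simp: algebra_simps)
    qed auto
    then obtain k where k: "\<And>t. t \<in> {0..T} \<Longrightarrow> y t * exp (- (a 1 * t)) = k" by blast
    have "y (T / 2) = 0" using k[OF T_in(1)] k[OF T_in(3)] ends by auto
    moreover have "y (T / 2) > 0" using \<gamma>(4)[of "T / 2"] T by (simp add: y_def)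
    ultimately show False by simp
  qed
  ultimately have "p\<^sup>2 = q\<^sup>2" by simp
  then show ?thesis using p T by (auto simp: power2_eq_iff)
qed

theorem proposition3:
  fixes n m :: nat
    and Fp Fm Hp Hm :: "real \<Rightarrow> real \<Rightarrow> real"
    and Xp Xm :: "real \<times> real \<Rightarrow> real \<times> real"
  assumes "n \<ge> 1" and "m \<ge> 1"
    and "homogeneous_poly2 (n + 1) Fp" and "\<exists>x y. Fp x y \<noteq> 0"
    and "homogeneous_poly2 (m + 1) Fm" and "\<exists>x y. Fm x y \<noteq> 0"
    and "Hp = (\<lambda>x y. (x\<^sup>2 + y\<^sup>2) / 2 + Fp x y)"
    and "Hm = (\<lambda>x y. (x\<^sup>2 + y\<^sup>2) / 2 + Fm x y)"
    and "Xp = hamiltonian_field Hp" and "Xm = hamiltonian_field Hm"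
    and "odd n" and "even m"
  shows "\<not> isochronous_sigma_center Xp Xm"
proof
  assume iso: "isochronous_sigma_center Xp Xm"
  obtain e1 where e1: "e1 > 0" "\<And>p. 0 < p \<Longrightarrow> p < e1 \<Longrightarrow> \<exists>T. closed_orbit_period Xp Xm p T"
    using iso unfolding isochronous_sigma_center_def sigma_center_def by blast
  obtain e2 T0 where e2: "e2 > 0"
    "\<And>p T. 0 < p \<Longrightarrow> p < e2 \<Longrightarrow> closed_orbit_period Xp Xm p T \<Longrightarrow> T = T0"
    using iso unfolding isochronous_sigma_center_def by blast
  define j where "j = m - 1"
  have j: "m + 1 = j + 2" "j \<ge> 1" "odd j"
    using \<open>m \<ge> 1\<close> \<open>even m\<close> by (auto simp: j_def elim!: evenE)
  define G where "G = (\<lambda>x y. Fm x (- y))"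
  have G: "homogeneous_poly2 (j + 2) G"
    using homogeneous_reflect[OF assms(5)] unfolding G_def j(1) .
  have G_neg: "G (- x) (- y) = - G x y" for x y
    using homogeneous_scale[OF G, of "-1" x y] j(3) by simp
  define Hr where "Hr = (\<lambda>x y. (x\<^sup>2 + y\<^sup>2) / 2 + G x y)"
  have reflect: "upper_arc (hamiltonian_field Hr) p q T" if "lower_arc Xm p q T" for p q T
    using lower_arc_imp_upper_arc_reflect[OF assms(5)] that
    unfolding Hr_def G_def assms by blast
  obtain d where d: "d > 0" "\<And>p q T s. 0 < p \<Longrightarrow> p < d \<Longrightarrow> upper_arc (hamiltonian_field Hr) p q T \<Longrightarrow>
      s = sqrt (2 * Hr p 0) \<Longrightarrow> Hr q 0 = Hr p 0 \<and>
      T = integral {0..pi} (\<lambda>t. Phi (real j / 2) (- 2 * s ^ j * G (cos t) (sin t)))"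
    using upper_arc_period[OF G j(2) Hr_def] by blast
  define g where "g = (\<lambda>t. - 2 * G (cos t) (sin t))"
  \<comment> \<open>Equal energies at \<open>p\<close> and \<open>- p\<close> together with the
    oddness of \<open>G\<close> force \<open>G p 0 = 0\<close>, so the energy parameter
    \<open>s\<close> equals \<open>p\<close>.\<close>
  have Tm: "T = integral {0..pi} (\<lambda>t. Phi (real j / 2) (p ^ j * g t))"
    if p: "0 < p" "p < d" and arc: "lower_arc Xm p (- p) T" for p T
  proof -
    have "Hr (- p) 0 = Hr p 0" using d(2)[OF p reflect[OF arc] refl] by blast
    then have "G p 0 = 0" using G_neg[of p 0] by (simp add: Hr_def)
    then have "p = sqrt (2 * Hr p 0)" using p by (simp add: Hr_def)
    with d(2)[OF p reflect[OF arc] this] show ?thesis by (simp add: g_def mult_ac)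
  qed
  have g: "C2 g" unfolding g_def by (intro C2_mult C2_const C2_homogeneous_trig[OF G])
  have g_rep: "\<exists>s\<in>{0..pi}. \<bar>g t\<bar> = \<bar>g s\<bar>" for t
    using homogeneous_trig_rep[OF G, of t] j(3) by (force simp: g_def)
  obtain t1 where g_nz: "g t1 \<noteq> 0"
  proof -
    obtain x y where "Fm x y \<noteq> 0" using assms(6) by blast
    moreover obtain r t where "x = r * cos t" "- y = r * sin t" using polar_Ex by blast
    moreover from this have "- (r * sin t) = y" by simp
    ultimately have "G (r * cos t) (r * sin t) \<noteq> 0" by (simp add: G_def)
    then have "g t \<noteq> 0" using homogeneous_scale[OF G] by (auto simp: g_def)
    then show thesis by (rule that)
  qed
  have no_const: "\<exists>p. 0 < p \<and> p < p1 \<and> integral {0..pi} (\<lambda>t. Phi c (e p * f t))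
      + integral {0..pi} (\<lambda>t. Phi (real j / 2) (p ^ j * g t)) \<noteq> S"
    if "c > 0" "C2 f" "\<And>t. \<exists>s\<in>{0..pi}. f t = f s"
      "E holomorphic_on UNIV" "\<And>x. E (of_real x) = complex_of_real (e x)"
      "\<And>x. e (- x) = e x" "e 0 = 0" "p1 > 0" for c f E e p1 S
    by (rule period_sum_not_constant[where E = E]) (fact that g g_rep g_nz j(3) | use j(2) in simp)+
  show False
  proof (cases "n = 1")
    case True
    then have F: "homogeneous_poly2 2 Fp" using assms(3) by (simp add: numeral_2_eq_2)
    have orbit: "\<exists>Tp Tm. upper_arc Xp p (- p) Tp \<and> lower_arc Xm p (- p) Tm \<and> Tp + Tm = T0"
      if p: "0 < p" "p < min e1 e2" for p
    proof -
      obtain T where T: "closed_orbit_period Xp Xm p T" using e1 p by auto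
      then obtain q Tp Tm where q: "upper_arc Xp p q Tp" "lower_arc Xm p q Tm" "T = Tp + Tm"
        unfolding closed_orbit_period_def by blast
      have "q = - p" using upper_arc_linear_endpoint[OF F, of p q Tp] q(1) p unfolding assms by blast
      with q e2(2)[OF p(1) _ T] p show ?thesis by auto
    qed
    \<comment> \<open>Any fixed admissible amplitude: scaling its upper arc gives, at every other
      \<open>p\<close>, an upper arc of the same time \<open>Tp\<close> to combine with the lower
      arc there.\<close>
    define p0 where "p0 = min e1 e2 / 2"
    have p0: "0 < p0" "p0 < min e1 e2" using e1 e2 by (auto simp: p0_def)
    obtain Tp where Tp: "upper_arc Xp p0 (- p0) Tp" using orbit[OF p0] by blast
    have "T = T0 - Tp" if p: "0 < p" "p < min e1 e2" and arc: "lower_arc Xm p (- p) T" for p T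
    proof -
      have "upper_arc Xp (p / p0 * p0) (p / p0 * - p0) Tp"
        using upper_arc_linear_scale[OF F, of p0 "- p0" Tp "p / p0"] Tp p p0 unfolding assms by auto
      then have "upper_arc Xp p (- p) Tp" using p0 by simp
      with arc have "closed_orbit_period Xp Xm p (Tp + T)" unfolding closed_orbit_period_def by blast
      from e2(2)[OF p(1) _ this] p show ?thesis by simp
    qed
    then have I2: "integral {0..pi} (\<lambda>t. Phi (real j / 2) (p ^ j * g t)) = T0 - Tp"
      if p: "0 < p" "p < min d (min e1 e2)" for p
      using orbit[of p] Tm[of p] p by (metis min_less_iff_conj)
    \<comment> \<open>The constant upper time is imitated by a zero argument:
      \<open>Phi 1 0 = 1\<close> contributes \<open>pi\<close>, which is added to the right-hand
      side.\<close>
    have "\<exists>p. 0 < p \<and> p < min d (min e1 e2) \<and> integral {0..pi} (\<lambda>t. Phi 1 (0 * 0))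
      + integral {0..pi} (\<lambda>t. Phi (real j / 2) (p ^ j * g t)) \<noteq> pi + (T0 - Tp)"
      by (rule no_const[where f = "\<lambda>_. 0" and e = "\<lambda>_. 0" and E = "\<lambda>_. 0"])
        (use j d e1 e2 in \<open>auto intro!: C2_const bexI[of _ 0]\<close>)
    then show False using I2 by (auto simp: Phi_0)
  next
    case False
    define k where "k = n - 1"
    have k: "n + 1 = k + 2" "k \<ge> 1" "even k" using False \<open>odd n\<close> by (auto simp: k_def elim!: oddE)
    then obtain N where N: "k = 2 * N" "N > 0" by (auto elim!: evenE)
    have F: "homogeneous_poly2 (k + 2) Fp" using assms(3) k by simp
    have F_neg: "Fp (- x) (- y) = Fp x y" for x y
      using homogeneous_scale[OF F, of "-1" x y] k(3) by simp
    define a where "a = Fp 1 0"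
    have Fa: "Fp p 0 = a * p ^ (k + 2)" for p
      using homogeneous_scale[OF F, of p 1 0] by (simp add: a_def)
    obtain d' where d': "d' > 0" "\<And>p q T s. 0 < p \<Longrightarrow> p < d' \<Longrightarrow> upper_arc (hamiltonian_field Hp) p q T \<Longrightarrow>
      s = sqrt (2 * Hp p 0) \<Longrightarrow> 0 < Hp p 0 \<and>
      p = s * exp (beta_inv (real k / 2) (- 2 * s ^ k * Fp 1 0) / 2) \<and>
      - q = s * exp (beta_inv (real k / 2) (- 2 * s ^ k * Fp (- 1) 0) / 2) \<and>
      T = integral {0..pi} (\<lambda>t. Phi (real k / 2) (- 2 * s ^ k * Fp (cos t) (sin t)))"
      using upper_arc_period[OF F k(2) assms(7)] by blast
    \<comment> \<open>This is \<open>s ^ k\<close> as a function of \<open>p\<close>: on the axis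
      \<open>s ^ 2 = p ^ 2 + 2 * a * p ^ (k + 2)\<close>, and \<open>k = 2 * N\<close>. As a
      polynomial it extends to an entire function.\<close>
    define e where "e = (\<lambda>p::real. (p\<^sup>2 + 2 * a * p ^ (k + 2)) ^ N)"
    define f where "f = (\<lambda>t. - 2 * Fp (cos t) (sin t))"
    have sum: "integral {0..pi} (\<lambda>t. Phi (real k / 2) (e p * f t))
        + integral {0..pi} (\<lambda>t. Phi (real j / 2) (p ^ j * g t)) = T0"
      if p: "0 < p" "p < min (min d d') (min e1 e2)" for p
    proof -
      obtain T where T: "closed_orbit_period Xp Xm p T" using e1 p by auto
      then obtain q Tp Tm where q: "upper_arc Xp p q Tp" "lower_arc Xm p q Tm" "T = Tp + Tm"
        unfolding closed_orbit_period_def by blast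
      define s where "s = sqrt (2 * Hp p 0)"
      have "p < d'" using p by simp
      note P = d'(2)[OF p(1) this q(1)[unfolded assms(9)] s_def]
      \<comment> \<open>The endpoint formulas for \<open>p\<close> and \<open>- q\<close> coincide
        because the even form has equal values at \<open>(1, 0)\<close> and
        \<open>(- 1, 0)\<close>.\<close>
      have "q = - p" using P F_neg[of 1 0] by simp
      have "s\<^sup>2 = p\<^sup>2 + 2 * a * p ^ (k + 2)"
        using P by (simp add: s_def assms(7) Fa algebra_simps)
      then have "s ^ k = e p" by (simp add: e_def N(1) power_mult)
      then have "Tp = integral {0..pi} (\<lambda>t. Phi (real k / 2) (e p * f t))"
        using P by (simp add: f_def mult_ac)
      moreover have "Tm = integral {0..pi} (\<lambda>t. Phi (real j / 2) (p ^ j * g t))"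
        using Tm[of p Tm] p q(2) \<open>q = - p\<close> by simp
      moreover have "Tp + Tm = T0" using e2(2)[OF p(1) _ T] p q(3) by simp
      ultimately show ?thesis by simp
    qed
    have "\<exists>p. 0 < p \<and> p < min (min d d') (min e1 e2) \<and> integral {0..pi} (\<lambda>t. Phi (real k / 2) (e p * f t))
      + integral {0..pi} (\<lambda>t. Phi (real j / 2) (p ^ j * g t)) \<noteq> T0"
    proof (rule no_const[where E = "\<lambda>w. (w\<^sup>2 + 2 * of_real a * w ^ (k + 2)) ^ N"])
      show "C2 f" unfolding f_def by (intro C2_mult C2_const C2_homogeneous_trig[OF F])
      show "\<exists>s\<in>{0..pi}. f t = f s" for t
        using homogeneous_trig_rep[OF F, of t] k(3) by (force simp: f_def)
      show "e (- x) = e x" for x using k(3) by (simp add: e_def)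
      show "e 0 = 0" using N by (simp add: e_def)
    qed (use j k d d' e1 e2 in \<open>auto intro!: holomorphic_intros simp: e_def\<close>)
    then show False using sum by blast
  qed
qed

end
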